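(* The Cartan canonical connection $C\Gamma_{[3]}$ of the rheonomic Chernov metric $$F_{[3]}(t,y)=\sqrt{h^{11}(t)}\cdot\sqrt[3]{y_1^1y_1^2y_1^3+y_1^1y_1^2y_1^4+y_1^1y_1^3y_1^4+y_1^2y_1^3y_1^4}$$ has three effective local curvature d-tensors: $$R_{ijk}^l=\frac14\varkappa_{11}^1\varkappa_{11}^1S_{i(j)(k)}^{l(1)(1)},\qquad P_{ij(k)}^{l\ (1)}=\frac12\varkappa_{11}^1S_{i(j)(k)}^{l(1)(1)},$$ $$S_{i(j)(k)}^{l(1)(1)}=\frac{\partial C_{i(j)}^{l(1)}}{\partial y_1^k}-\frac{\partial C_{i(k)}^{l(1)}}{\partial y_1^j}+C_{i(j)}^{m(1)}C_{m(k)}^{l(1)}-C_{i(k)}^{m(1)}C_{m(j)}^{l(1)},$$ while the other two curvature d-tensors $R_{i1k}^l$ and $P_{i1(k)}^{l\ (1)}$ vanish.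
   Context: $M^4$ is a smooth $4$-dimensional manifold with local coordinates $(x^1,\dots,x^4)$; $J^1(\mathbb{R},M^4)$ has local coordinates $(t,x^1,\dots,x^4,y_1^1,\dots,y_1^4)$. $h_{11}(t)>0$ is a Riemannian metric on $\mathbb{R}$, $h^{11}=1/h_{11}$, and $\varkappa_{11}^1=\frac{h^{11}}{2}\frac{dh_{11}}{dt}$. Latin indices run from $1$ to $4$, repeated indices are summed; cube roots are real. Everything is considered on the open set where $S_{[3]111}=y_1^1y_1^2y_1^3+y_1^1y_1^2y_1^4+y_1^1y_1^3y_1^4+y_1^2y_1^3y_1^4\neq0$ and the Hessian $(\partial^2S_{[3]111}/\partial y_1^i\partial y_1^j)$ is invertible. The fundamental metrical d-tensor is $g_{[3]ij}=\frac{h_{11}}{2}\frac{\partial^2F_{[3]}^2}{\partial y_1^i\partial y_1^j}$, with inverse $(g_{[3]}^{jk})$. The canonical nonlinear connection of $F_{[3]}$ is $\Gamma_{[3]}=(M_{(1)1}^{(i)}=-\varkappa_{11}^1y_1^i,\ N_{(1)j}^{(i)}=-\frac{\varkappa_{11}^1}{2}\delta_j^i)$, giving the adapted basis of vector fields $$\frac{\delta}{\delta t}=\frac{\partial}{\partial t}+\varkappa_{11}^1y_1^p\frac{\partial}{\partial y_1^p},\qquad \frac{\delta}{\delta x^i}=\frac{\partial}{\partial x^i}+\frac{\varkappa_{11}^1}{2}\frac{\partial}{\partial y_1^i},\qquad\frac{\partial}{\partial y_1^i}.$$ The Cartan canonical connection $C\Gamma_{[3]}=(\varkappa_{11}^1,G_{j1}^k,L_{jk}^i,C_{j(k)}^{i(1)})$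 has $$G_{j1}^k=\frac{g_{[3]}^{km}}{2}\frac{\delta g_{[3]mj}}{\delta t},\qquad L_{jk}^i=\frac{g_{[3]}^{im}}{2}\left(\frac{\delta g_{[3]jm}}{\delta x^k}+\frac{\delta g_{[3]km}}{\delta x^j}-\frac{\delta g_{[3]jk}}{\delta x^m}\right),$$ $$C_{j(k)}^{i(1)}=\frac{g_{[3]}^{im}}{2}\left(\frac{\partial g_{[3]jm}}{\partial y_1^k}+\frac{\partial g_{[3]km}}{\partial y_1^j}-\frac{\partial g_{[3]jk}}{\partial y_1^m}\right),$$ and is the ($h$-normal) linear connection $\nabla$ on $J^1(\mathbb{R},M^4)$ given by $$\nabla_{\frac{\delta}{\delta t}}\tfrac{\delta}{\delta t}=\varkappa_{11}^1\tfrac{\delta}{\delta t},\quad \nabla_{\frac{\delta}{\delta t}}\tfrac{\delta}{\delta x^i}=G_{i1}^k\tfrac{\delta}{\delta x^k},\quad \nabla_{\frac{\delta}{\delta t}}\tfrac{\partial}{\partial y_1^i}=(G_{i1}^k-\delta_i^k\varkappa_{11}^1)\tfrac{\partial}{\partial y_1^k},$$ $$\nabla_{\frac{\delta}{\delta x^j}}\tfrac{\delta}{\delta t}=0,\quad \nabla_{\frac{\delta}{\delta x^j}}\tfrac{\delta}{\delta x^i}=L_{ij}^k\tfrac{\delta}{\delta x^k},\quad \nabla_{\frac{\delta}{\delta x^j}}\tfrac{\partial}{\partial y_1^i}=L_{ij}^k\tfrac{\partial}{\partial y_1^k},$$ $$\nabla_{\frac{\partial}{\partial y_1^j}}\tfrac{\delta}{\delta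 t}=0,\quad \nabla_{\frac{\partial}{\partial y_1^j}}\tfrac{\delta}{\delta x^i}=C_{i(j)}^{k(1)}\tfrac{\delta}{\delta x^k},\quad \nabla_{\frac{\partial}{\partial y_1^j}}\tfrac{\partial}{\partial y_1^i}=C_{i(j)}^{k(1)}\tfrac{\partial}{\partial y_1^k}.$$ Its curvature is $\mathbf{R}(X,Y)Z=\nabla_X\nabla_YZ-\nabla_Y\nabla_XZ-\nabla_{[X,Y]}Z$. The five curvature d-tensors characterizing such a connection are defined by $$\mathbf{R}\left(\tfrac{\delta}{\delta x^k},\tfrac{\delta}{\delta t}\right)\tfrac{\delta}{\delta x^i}=R_{i1k}^l\tfrac{\delta}{\delta x^l},\quad \mathbf{R}\left(\tfrac{\delta}{\delta x^k},\tfrac{\delta}{\delta x^j}\right)\tfrac{\delta}{\delta x^i}=R_{ijk}^l\tfrac{\delta}{\delta x^l},\quad \mathbf{R}\left(\tfrac{\partial}{\partial y_1^k},\tfrac{\delta}{\delta t}\right)\tfrac{\delta}{\delta x^i}=P_{i1(k)}^{l\ (1)}\tfrac{\delta}{\delta x^l},$$ $$\mathbf{R}\left(\tfrac{\partial}{\partial y_1^k},\tfrac{\delta}{\delta x^j}\right)\tfrac{\delta}{\delta x^i}=P_{ij(k)}^{l\ (1)}\tfrac{\delta}{\delta x^l},\quad \mathbf{R}\left(\tfrac{\partial}{\partial y_1^k},\tfrac{\partial}{\partial y_1^j}\right)\tfrac{\delta}{\delta x^i}=S_{i(j)(k)}^{l(1)(1)}\tfrac{\delta}{\delta x^l}.$$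 "Effective" means not vanishing identically in general. *)

theory Defs
  imports "HOL-Analysis.Analysis"
begin

section \<open>Local coordinates on the 1-jet space and vector fields\<close>

text \<open>
  Everything is written in the coordinates \<open>(t, x, y)\<close> which a chart of the 4-manifold with image
  \<open>U\<close> induces on the 1-jet space. Here \<open>t\<close> ranges over the reals, \<open>x\<close> over \<open>U\<close> and the
  \<open>y $ i\<close> are the jet coordinates. The index type \<open>4\<close> has the elements
  \<open>1, 2, 3\<close> and \<open>4 = 0\<close>. The same type serves for tangent vectors, written in the natural basis.
\<close>

type_synonym jet = "real \<times> (real^4) \<times> (real^4)"

abbreviation time :: "jet \<Rightarrow> real" where "time p \<equiv> fst p"
abbreviation vel :: "jet \<Rightarrow> real^4" where "vel p \<equiv> snd (snd p)"

definition act :: "(jet \<Rightarrow> jet) \<Rightarrow> (jet \<Rightarrow> 'a::real_normed_vector) \<Rightarrow> jet \<Rightarrow> 'a" where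
  "act X f p = frechet_derivative f (at p) (X p)"

definition lie_bracket :: "(jet \<Rightarrow> jet) \<Rightarrow> (jet \<Rightarrow> jet) \<Rightarrow> jet \<Rightarrow> jet" where
  "lie_bracket X Y p = act X Y p - act Y X p"

definition partial_t :: "jet \<Rightarrow> jet" where
  "partial_t p = (1, 0, 0)"

definition partial_x :: "4 \<Rightarrow> jet \<Rightarrow> jet" where
  "partial_x i p = (0, axis i 1, 0)"

definition partial_y :: "4 \<Rightarrow> jet \<Rightarrow> jet" where
  "partial_y i p = (0, 0, axis i 1)"

section \<open>The temporal metric\<close>

definition temporal_metric :: "(real \<Rightarrow> real) \<Rightarrow> bool" where
  "temporal_metric h \<longleftrightarrow>
     (\<forall>t. h t > 0) \<and> (\<forall>n t. ((deriv ^^ n) h) differentiable (at t))"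

definition kappa :: "(real \<Rightarrow> real) \<Rightarrow> real \<Rightarrow> real" where
  "kappa h t = (1 / h t) / 2 * deriv h t"

section \<open>The rheonomic Chernov metric\<close>

definition S3 :: "jet \<Rightarrow> real" where
  "S3 p = (let y = vel p in
     y$1 * y$2 * y$3 + y$1 * y$2 * y$4 + y$1 * y$3 * y$4 + y$2 * y$3 * y$4)"

definition hessian_S3 :: "jet \<Rightarrow> real^4^4" where
  "hessian_S3 p = (\<chi> i j. act (partial_y i) (act (partial_y j) S3) p)"

definition chernov_domain :: "(real^4) set \<Rightarrow> jet set" where
  "chernov_domain U = {(t, x, y). x \<in> U \<and> S3 (t, x, y) \<noteq> 0 \<and> invertible (hessian_S3 (t, x, y))}"

definition F3 :: "(real \<Rightarrow> real) \<Rightarrow> jet \<Rightarrow> real" where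
  "F3 h p = sqrt (1 / h (time p)) * root 3 (S3 p)"

definition g3 :: "(real \<Rightarrow> real) \<Rightarrow> 4 \<Rightarrow> 4 \<Rightarrow> jet \<Rightarrow> real" where
  "g3 h i j p =
     h (time p) / 2 * act (partial_y i) (act (partial_y j) (\<lambda>q. (F3 h q)\<^sup>2)) p"

definition g3_inv :: "(real \<Rightarrow> real) \<Rightarrow> 4 \<Rightarrow> 4 \<Rightarrow> jet \<Rightarrow> real" where
  "g3_inv h j k p = matrix_inv (\<chi> a b. g3 h a b p) $ j $ k"

section \<open>The canonical nonlinear connection and its adapted basis\<close>

definition nonlin_M :: "(real \<Rightarrow> real) \<Rightarrow> 4 \<Rightarrow> jet \<Rightarrow> real" where
  "nonlin_M h i p = - kappa h (time p) * vel p $ i"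

definition nonlin_N :: "(real \<Rightarrow> real) \<Rightarrow> 4 \<Rightarrow> 4 \<Rightarrow> jet \<Rightarrow> real" where
  "nonlin_N h i j p = - (kappa h (time p) / 2) * (if i = j then 1 else 0)"

definition delta_t :: "(real \<Rightarrow> real) \<Rightarrow> jet \<Rightarrow> jet" where
  "delta_t h p = partial_t p - (\<Sum>k\<in>UNIV. nonlin_M h k p *\<^sub>R partial_y k p)"

definition delta_x :: "(real \<Rightarrow> real) \<Rightarrow> 4 \<Rightarrow> jet \<Rightarrow> jet" where
  "delta_x h i p = partial_x i p - (\<Sum>k\<in>UNIV. nonlin_N h k i p *\<^sub>R partial_y k p)"

datatype adapted_index = Temporal | Horizontal 4 | Vertical 4

instance adapted_index :: finite
proof
  have "(UNIV :: adapted_index set) = {Temporal} \<union> range Horizontal \<union> range Vertical"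
  proof (intro set_eqI iffI)
    fix a :: adapted_index
    show "a \<in> {Temporal} \<union> range Horizontal \<union> range Vertical" by (cases a) auto
  qed simp
  then show "finite (UNIV :: adapted_index set)"
    by (metis finite.emptyI finite_Un finite_code finite_imageI finite_insert)
qed

fun frame :: "(real \<Rightarrow> real) \<Rightarrow> adapted_index \<Rightarrow> jet \<Rightarrow> jet" where
  "frame h Temporal = delta_t h"
| "frame h (Horizontal i) = delta_x h i"
| "frame h (Vertical i) = partial_y i"

text \<open>
  The dual coframe \<open>dt\<close>, \<open>dx\<^sup>i\<close>, \<open>\<delta>y\<^sup>i = dy\<^sup>i + M\<^sup>i dt + N\<^sup>i\<^sub>j dx\<^sup>j\<close>, applied to a tangent vector at \<open>p\<close>.
\<close>

fun coframe :: "(real \<Rightarrow> real) \<Rightarrow> adapted_index \<Rightarrow> jet \<Rightarrow> jet \<Rightarrow> real" where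
  "coframe h Temporal p (\<tau>, \<xi>, \<eta>) = \<tau>"
| "coframe h (Horizontal i) p (\<tau>, \<xi>, \<eta>) = \<xi> $ i"
| "coframe h (Vertical i) p (\<tau>, \<xi>, \<eta>) =
     \<eta> $ i + nonlin_M h i p * \<tau> + (\<Sum>j\<in>UNIV. nonlin_N h i j p * \<xi> $ j)"

section \<open>The Cartan canonical connection\<close>

text \<open>In \<open>cartan_G h k j\<close>, \<open>cartan_L h i j k\<close> and \<open>cartan_C h i j k\<close> the upper index comes first.\<close>

definition cartan_G :: "(real \<Rightarrow> real) \<Rightarrow> 4 \<Rightarrow> 4 \<Rightarrow> jet \<Rightarrow> real" where
  "cartan_G h k j p = (\<Sum>m\<in>UNIV. g3_inv h k m p / 2 * act (delta_t h) (g3 h m j) p)"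

definition cartan_L :: "(real \<Rightarrow> real) \<Rightarrow> 4 \<Rightarrow> 4 \<Rightarrow> 4 \<Rightarrow> jet \<Rightarrow> real" where
  "cartan_L h i j k p = (\<Sum>m\<in>UNIV. g3_inv h i m p / 2 *
     (act (delta_x h k) (g3 h j m) p + act (delta_x h j) (g3 h k m) p
        - act (delta_x h m) (g3 h j k) p))"

definition cartan_C :: "(real \<Rightarrow> real) \<Rightarrow> 4 \<Rightarrow> 4 \<Rightarrow> 4 \<Rightarrow> jet \<Rightarrow> real" where
  "cartan_C h i j k p = (\<Sum>m\<in>UNIV. g3_inv h i m p / 2 *
     (act (partial_y k) (g3 h j m) p + act (partial_y j) (g3 h k m) p
        - act (partial_y m) (g3 h j k) p))"

text \<open>\<open>cartan_table h a b\<close> is the derivative of \<open>frame h b\<close> in the direction of \<open>frame h a\<close>.\<close>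

fun cartan_table :: "(real \<Rightarrow> real) \<Rightarrow> adapted_index \<Rightarrow> adapted_index \<Rightarrow> jet \<Rightarrow> jet" where
  "cartan_table h Temporal Temporal p = kappa h (time p) *\<^sub>R delta_t h p"
| "cartan_table h Temporal (Horizontal i) p = (\<Sum>k\<in>UNIV. cartan_G h k i p *\<^sub>R delta_x h k p)"
| "cartan_table h Temporal (Vertical i) p =
     (\<Sum>k\<in>UNIV. (cartan_G h k i p - (if k = i then 1 else 0) * kappa h (time p)) *\<^sub>R partial_y k p)"
| "cartan_table h (Horizontal j) Temporal p = 0"
| "cartan_table h (Horizontal j) (Horizontal i) p = (\<Sum>k\<in>UNIV. cartan_L h k i j p *\<^sub>R delta_x h k p)"
| "cartan_table h (Horizontal j) (Vertical i) p = (\<Sum>k\<in>UNIV. cartan_L h k i j p *\<^sub>R partial_y k p)"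
| "cartan_table h (Vertical j) Temporal p = 0"
| "cartan_table h (Vertical j) (Horizontal i) p = (\<Sum>k\<in>UNIV. cartan_C h k i j p *\<^sub>R delta_x h k p)"
| "cartan_table h (Vertical j) (Vertical i) p = (\<Sum>k\<in>UNIV. cartan_C h k i j p *\<^sub>R partial_y k p)"

text \<open>
  The linear connection with these values on the adapted basis: for \<open>X = X\<^sup>a e\<^sub>a\<close> and \<open>Y = Y\<^sup>b e\<^sub>b\<close>,
  linearity in \<open>X\<close> over functions and the Leibniz rule in \<open>Y\<close> force
  \<open>\<nabla>\<^sub>X Y = X(Y\<^sup>b) e\<^sub>b + X\<^sup>a Y\<^sup>b \<nabla>\<^bsub>e\<^sub>a\<^esub> e\<^sub>b\<close>.
\<close>

definition nabla :: "(real \<Rightarrow> real) \<Rightarrow> (jet \<Rightarrow> jet) \<Rightarrow> (jet \<Rightarrow> jet) \<Rightarrow> jet \<Rightarrow> jet" where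
  "nabla h X Y p =
     (\<Sum>b\<in>UNIV. act X (\<lambda>q. coframe h b q (Y q)) p *\<^sub>R frame h b p)
     + (\<Sum>a\<in>UNIV. \<Sum>b\<in>UNIV.
          (coframe h a p (X p) * coframe h b p (Y p)) *\<^sub>R cartan_table h a b p)"

section \<open>Curvature\<close>

definition curvature ::
  "(real \<Rightarrow> real) \<Rightarrow> (jet \<Rightarrow> jet) \<Rightarrow> (jet \<Rightarrow> jet) \<Rightarrow> (jet \<Rightarrow> jet) \<Rightarrow> jet \<Rightarrow> jet" where
  "curvature h X Y Z p =
     nabla h X (nabla h Y Z) p - nabla h Y (nabla h X Z) p - nabla h (lie_bracket X Y) Z p"

text \<open>
  Each curvature d-tensor is the family of \<open>\<delta>/\<delta>x\<^sup>l\<close>-coefficients of a curvature vector, with the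
  arguments ordered \<open>l i j k\<close> (or \<open>l i k\<close> when the middle lower index is the temporal one). By lemma
  \<open>curvature_horizontal\<close> below these vectors have no other components.
\<close>

definition R_th :: "(real \<Rightarrow> real) \<Rightarrow> 4 \<Rightarrow> 4 \<Rightarrow> 4 \<Rightarrow> jet \<Rightarrow> real" where
  "R_th h l i k p = coframe h (Horizontal l) p (curvature h (delta_x h k) (delta_t h) (delta_x h i) p)"

definition R_hh :: "(real \<Rightarrow> real) \<Rightarrow> 4 \<Rightarrow> 4 \<Rightarrow> 4 \<Rightarrow> 4 \<Rightarrow> jet \<Rightarrow> real" where
  "R_hh h l i j k p = coframe h (Horizontal l) p (curvature h (delta_x h k) (delta_x h j) (delta_x h i) p)"

definition P_tv :: "(real \<Rightarrow> real) \<Rightarrow> 4 \<Rightarrow> 4 \<Rightarrow> 4 \<Rightarrow> jet \<Rightarrow> real" where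
  "P_tv h l i k p = coframe h (Horizontal l) p (curvature h (partial_y k) (delta_t h) (delta_x h i) p)"

definition P_hv :: "(real \<Rightarrow> real) \<Rightarrow> 4 \<Rightarrow> 4 \<Rightarrow> 4 \<Rightarrow> 4 \<Rightarrow> jet \<Rightarrow> real" where
  "P_hv h l i j k p = coframe h (Horizontal l) p (curvature h (partial_y k) (delta_x h j) (delta_x h i) p)"

definition S_vv :: "(real \<Rightarrow> real) \<Rightarrow> 4 \<Rightarrow> 4 \<Rightarrow> 4 \<Rightarrow> 4 \<Rightarrow> jet \<Rightarrow> real" where
  "S_vv h l i j k p = coframe h (Horizontal l) p (curvature h (partial_y k) (partial_y j) (delta_x h i) p)"

text \<open>
  Used to render ``effective''. The tensors \<open>R_hh\<close> and \<open>P_hv\<close> carry factors \<open>\<kappa>\<close>, so they do vanish for a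
  constant temporal metric. Effectiveness of these two is asserted for every \<open>h\<close> with \<open>\<kappa>\<close> not
  identically zero. Such \<open>h\<close> exist, see \<open>temporal_metric_exp\<close> and \<open>kappa_exp\<close> below.
\<close>

definition not_identically_zero ::
  "jet set \<Rightarrow> (4 \<Rightarrow> 4 \<Rightarrow> 4 \<Rightarrow> 4 \<Rightarrow> jet \<Rightarrow> real) \<Rightarrow> bool" where
  "not_identically_zero D A \<longleftrightarrow> (\<exists>p\<in>D. \<exists>l i j k. A l i j k p \<noteq> 0)"

section \<open>Consistency of the definitions\<close>

lemma UNIV_adapted_index: "(UNIV :: adapted_index set) = insert Temporal (range Horizontal \<union> range Vertical)"
proof (intro set_eqI iffI)
  fix a :: adapted_index
  show "a \<in> insert Temporal (range Horizontal \<union> range Vertical)" by (cases a) auto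
qed simp

lemma sum_adapted_index:
  fixes f :: "adapted_index \<Rightarrow> 'a::comm_monoid_add"
  shows "(\<Sum>a\<in>UNIV. f a) = f Temporal + (\<Sum>i\<in>UNIV. f (Horizontal i)) + (\<Sum>i\<in>UNIV. f (Vertical i))"
proof -
  have "(\<Sum>a\<in>UNIV. f a) = f Temporal + sum f (range Horizontal \<union> range Vertical)"
    unfolding UNIV_adapted_index by (subst sum.insert) auto
  also have "sum f (range Horizontal \<union> range Vertical) = sum f (range Horizontal) + sum f (range Vertical)"
    by (rule sum.union_disjoint) auto
  also have "sum f (range Horizontal) = (\<Sum>i\<in>UNIV. f (Horizontal i))"
    by (subst sum.reindex) (auto simp: inj_on_def)
  also have "sum f (range Vertical) = (\<Sum>i\<in>UNIV. f (Vertical i))"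
    by (subst sum.reindex) (auto simp: inj_on_def)
  finally show ?thesis by (simp add: add.assoc)
qed

lemma sum_partial_y: "(\<Sum>k\<in>UNIV. c k *\<^sub>R partial_y k p) = (0, 0, \<chi> k. c k)"
proof -
  have "(\<Sum>k\<in>UNIV. c k *\<^sub>R axis k (1::real)) = (\<chi> k. c k)"
    by (simp add: vec_eq_iff axis_def if_distrib cong: if_cong)
  then show ?thesis
    by (simp add: partial_y_def prod_eq_iff fst_sum snd_sum)
qed

lemma delta_t_eq: "delta_t h p = (1, 0, kappa h (time p) *\<^sub>R vel p)"
  unfolding delta_t_def sum_partial_y
  by (simp add: partial_t_def nonlin_M_def vec_eq_iff)

lemma delta_x_eq: "delta_x h i p = (0, axis i 1, (kappa h (time p) / 2) *\<^sub>R axis i 1)"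
  unfolding delta_x_def sum_partial_y
  by (simp add: partial_x_def nonlin_N_def vec_eq_iff axis_def)

lemma sum_nonlin_N: "(\<Sum>j\<in>UNIV. nonlin_N h i j p * c j) = - (kappa h (time p) / 2) * c i"
proof -
  have "nonlin_N h i j p * c j = (if j = i then - (kappa h (time p) / 2) * c i else 0)" for j
    by (simp add: nonlin_N_def)
  then show ?thesis by simp
qed

lemma coframe_frame: "coframe h a p (frame h b p) = (if a = b then 1 else 0)"
  by (cases a; cases b)
     (auto simp: delta_t_eq delta_x_eq partial_y_def nonlin_M_def sum_nonlin_N axis_def)

lemma frame_expansion: "v = (\<Sum>a\<in>UNIV. coframe h a p v *\<^sub>R frame h a p)"
proof -
  obtain \<tau> \<xi> \<eta> where v: "v = (\<tau>, \<xi>, \<eta>)" by (cases v)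
  have "(\<Sum>i\<in>UNIV. (\<xi> $ i) *\<^sub>R delta_x h i p) = (0, \<xi>, (kappa h (time p) / 2) *\<^sub>R \<xi>)"
    by (simp add: delta_x_eq prod_eq_iff fst_sum snd_sum vec_eq_iff axis_def if_distrib
                  mult.commute cong: if_cong)
  then show ?thesis
    unfolding sum_adapted_index v
    by (simp add: sum_partial_y delta_t_eq nonlin_M_def sum_nonlin_N vec_eq_iff)
qed

lemma act_const: "act X (\<lambda>q. c) p = 0"
  by (simp add: act_def)

lemma nabla_frame: "nabla h (frame h a) (frame h b) p = cartan_table h a b p"
proof -
  have "(\<Sum>a'\<in>UNIV. \<Sum>b'\<in>UNIV.
      ((if a' = a then 1 else 0) * (if b' = b then 1 else (0::real))) *\<^sub>R cartan_table h a' b' p)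
      = cartan_table h a b p"
    by (subst sum.remove[of _ a], simp, simp, subst sum.remove[of _ b], simp, simp) simp
  then show ?thesis
    by (simp add: nabla_def coframe_frame act_const)
qed

text \<open>\<open>\<nabla>\<close> preserves horizontality, so that the curvature d-tensors carry the full curvature vectors.\<close>

definition horizontal :: "(real \<Rightarrow> real) \<Rightarrow> (jet \<Rightarrow> jet) \<Rightarrow> bool" where
  "horizontal h Z \<longleftrightarrow> (\<forall>p. coframe h Temporal p (Z p) = 0 \<and> (\<forall>i. coframe h (Vertical i) p (Z p) = 0))"

lemma linear_coframe: "linear (coframe h a p)"
  by (rule linearI; cases a)
     (auto simp: algebra_simps sum.distrib sum_distrib_left)

lemma horizontal_nabla:
  assumes "horizontal h Z"
  shows "horizontal h (nabla h X Z)"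
proof -
  note Z = assms[unfolded horizontal_def, rule_format]
  note lin = linear_add[OF linear_coframe] linear_sum[OF linear_coframe]
    linear_scale[OF linear_coframe] linear_0[OF linear_coframe]
  have H: "coframe h Temporal p (delta_x h i p) = 0" "coframe h (Vertical k) p (delta_x h i p) = 0" for p i k
    using coframe_frame[of h Temporal p "Horizontal i"] coframe_frame[of h "Vertical k" p "Horizontal i"] by simp_all
  show ?thesis
    unfolding horizontal_def nabla_def sum_adapted_index
    by (simp add: Z lin H act_const del: coframe.simps)
qed

lemma horizontal_curvature:
  assumes "horizontal h Z"
  shows "horizontal h (curvature h X Y Z)"
  using horizontal_nabla[OF horizontal_nabla[OF assms]] horizontal_nabla[OF assms]
  by (simp add: horizontal_def curvature_def linear_diff[OF linear_coframe] del: coframe.simps)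

lemma curvature_horizontal:
  "curvature h X Y (delta_x h i) p =
     (\<Sum>l\<in>UNIV. coframe h (Horizontal l) p (curvature h X Y (delta_x h i) p) *\<^sub>R delta_x h l p)"
proof -
  have "horizontal h (delta_x h i)"
    using coframe_frame[of h _ _ "Horizontal i"] by (simp add: horizontal_def del: coframe.simps)
  then have "horizontal h (curvature h X Y (delta_x h i))"
    by (rule horizontal_curvature)
  then have "coframe h Temporal p (curvature h X Y (delta_x h i) p) = 0"
    and "\<And>k. coframe h (Vertical k) p (curvature h X Y (delta_x h i) p) = 0"
    unfolding horizontal_def by blast+
  then show ?thesis
    by (subst frame_expansion[of _ h p]) (simp add: sum_adapted_index del: coframe.simps)
qed

text \<open>There are temporal metrics for which \<open>\<kappa>\<close> vanishes nowhere.\<close>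

lemma temporal_metric_exp: "temporal_metric exp" and kappa_exp: "kappa exp t = 1 / 2"
proof -
  have "deriv exp = (exp :: real \<Rightarrow> real)"
    by (intro ext DERIV_imp_deriv DERIV_exp)
  then have "(deriv ^^ n) exp = (exp :: real \<Rightarrow> real)" for n
    by (induction n) simp_all
  then show "temporal_metric exp"
    by (auto simp: temporal_metric_def real_differentiable_def intro: DERIV_exp)
  show "kappa exp t = 1 / 2"
    using \<open>deriv exp = exp\<close> by (simp add: kappa_def)
qed

end

theory Submission
  imports Defs
begin

text \<open>
  Where \<open>S3\<close> does not vanish, \<open>g3\<close> is the Hessian in \<open>y\<close> of half the square of the cube root of \<open>S3\<close>,
  a function of \<open>y\<close> alone and homogeneous of degree 0. Its third derivatives are totally symmetric
  and, by Euler's identity, annihilated by \<open>y\<close>. Hence \<open>G = 0\<close>, \<open>L = (\<kappa>/2) C\<close>, and \<open>C\<close> is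
  homogeneous of degree -1, so that \<open>\<delta>C/\<delta>t = - \<kappa> C\<close>. Inserting this into the curvature formula
  for the adapted frame, the terms in \<open>R_th\<close> and \<open>P_tv\<close> cancel against the vertical brackets
  \<open>[\<delta>/\<delta>x, \<delta>/\<delta>t]\<close> and \<open>[\<partial>/\<partial>y, \<delta>/\<delta>t]\<close>, and the other three tensors are multiples of one another.
  For effectiveness, the lowered curvature of a Hessian metric is quadratic in the third
  derivatives, and it is nonzero at \<open>y = (1, 1, 1, 1)\<close>.
\<close>

section \<open>Gradient calculus and differentiability\<close>

lemma GDERIV_vec_nth: "GDERIV (\<lambda>y. y $ k) y :> (axis k 1 :: real^'n)"
  using bounded_linear.has_derivative[OF bounded_linear_vec_nth has_derivative_ident]
  by (simp add: gderiv_def inner_axis)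

lemma GDERIV_sum:
  assumes "\<And>i. i \<in> A \<Longrightarrow> GDERIV (f i) y :> D i"
  shows "GDERIV (\<lambda>x. \<Sum>i\<in>A. f i x) y :> (\<Sum>i\<in>A. D i)"
  using assms unfolding gderiv_def inner_sum_right by (intro has_derivative_sum) auto

text \<open>By the Leibniz expansion a determinant is polynomial in its entries. With Cramer's rule
  this yields differentiable Christoffel symbols.\<close>

lemma differentiable_det:
  fixes A :: "'b::real_normed_vector \<Rightarrow> real^'m^'m"
  assumes "\<And>i j. (\<lambda>x. A x $ i $ j) differentiable (at x)"
  shows "(\<lambda>x. det (A x)) differentiable (at x)"
proof -
  have "(\<lambda>x. \<Prod>i\<in>UNIV. A x $ i $ p i) differentiable (at x)" for p
  proof -
    have "((\<lambda>x. A x $ i $ p i) has_derivative frechet_derivative (\<lambda>x. A x $ i $ p i) (at x)) (at x)" for i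
      using assms frechet_derivative_works by blast
    then show ?thesis
      by (rule differentiableI[OF has_derivative_prod])
  qed
  then show ?thesis
    unfolding det_def by (intro differentiable_sum) (auto intro!: differentiable_mult)
qed

lemma GDERIV_differentiable: "GDERIV f x :> D \<Longrightarrow> f differentiable (at x)"
  unfolding gderiv_def differentiable_def by blast

lemma differentiable_transform_open:
  assumes "f differentiable (at x)" "open S" "x \<in> S" "\<And>y. y \<in> S \<Longrightarrow> f y = g y"
  shows "g differentiable (at x)"
proof -
  obtain D where "(f has_derivative D) (at x)"
    using assms(1) unfolding differentiable_def by blast
  then have "(g has_derivative D) (at x)"
    using assms(2-) by (rule has_derivative_transform_within_open)
  then show ?thesis
    unfolding differentiable_def by blast
qed

lemma continuous_on_differentiable:
  fixes f :: "'b::real_normed_vector \<Rightarrow> 'c::real_normed_vector"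
  assumes "\<And>x. f differentiable (at x)"
  shows "continuous_on UNIV f"
  using assms by (simp add: continuous_at_imp_continuous_on differentiable_imp_continuous_within)

section \<open>The Cartan connection of the two-thirds power of a cubic form\<close>

text \<open>Adjacent transpositions generate all permutations, so \<open>a\<close> is totally
  symmetric. It is the array of third partial derivatives of \<open>cub\<close>; the divisors 2 and
  3 below are the degrees in Euler's identity.\<close>

locale symmetric_cubic =
  fixes a :: "'n::finite \<Rightarrow> 'n \<Rightarrow> 'n \<Rightarrow> real"
  assumes swap12: "a i j k = a j i k" and swap23: "a i j k = a i k j"
begin

definition s2 :: "'n \<Rightarrow> 'n \<Rightarrow> real^'n \<Rightarrow> real" where
  "s2 i j y = (\<Sum>k\<in>UNIV. a i j k * y $ k)"

definition s1 :: "'n \<Rightarrow> real^'n \<Rightarrow> real" where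
  "s1 i y = (\<Sum>j\<in>UNIV. s2 i j y * y $ j) / 2"

definition cub :: "real^'n \<Rightarrow> real" where
  "cub y = (\<Sum>i\<in>UNIV. s1 i y * y $ i) / 3"

definition croot :: "real^'n \<Rightarrow> real" where
  "croot y = root 3 (cub y)"

text \<open>
  \<open>s1\<close> and \<open>s2\<close> are the first and second partial derivatives of \<open>cub\<close>, while \<open>energy2\<close>,
  \<open>energy3\<close>, \<open>energy4\<close> are the partial derivatives of order 2, 3, 4 of \<open>croot\<^sup>2 / 2\<close>.
\<close>

definition energy2 :: "'n \<Rightarrow> 'n \<Rightarrow> real^'n \<Rightarrow> real" where
  "energy2 i j y = s2 i j y / (3 * croot y) - s1 i y * s1 j y / (9 * croot y ^ 4)"

definition energy3 :: "'n \<Rightarrow> 'n \<Rightarrow> 'n \<Rightarrow> real^'n \<Rightarrow> real" where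
  "energy3 i j k y = a i j k / (3 * croot y)
     - (s2 i j y * s1 k y + s2 i k y * s1 j y + s2 j k y * s1 i y) / (9 * croot y ^ 4)
     + 4 * (s1 i y * s1 j y * s1 k y) / (27 * croot y ^ 7)"

definition energy4 :: "'n \<Rightarrow> 'n \<Rightarrow> 'n \<Rightarrow> 'n \<Rightarrow> real^'n \<Rightarrow> real" where
  "energy4 i j k l y =
     - (a i j k * s1 l y + a i j l * s1 k y + a i k l * s1 j y + a j k l * s1 i y
        + s2 i j y * s2 k l y + s2 i k y * s2 j l y + s2 i l y * s2 j k y) / (9 * croot y ^ 4)
     + 4 * (s2 i j y * s1 k y * s1 l y + s2 i k y * s1 j y * s1 l y + s2 i l y * s1 j y * s1 k y
        + s2 j k y * s1 i y * s1 l y + s2 j l y * s1 i y * s1 k y + s2 k l y * s1 i y * s1 j y)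
        / (27 * croot y ^ 7)
     - 28 * (s1 i y * s1 j y * s1 k y * s1 l y) / (81 * croot y ^ 10)"

section \<open>Symmetries and Euler identities of the cubic form\<close>

lemma s2_commute: "s2 i j y = s2 j i y"
  by (simp add: s2_def swap12)

lemma energy2_commute: "energy2 i j y = energy2 j i y"
  by (simp add: energy2_def s2_commute[of i] mult.commute)

lemma energy3_swap12: "energy3 i j k y = energy3 j i k y"
  using swap12[of i j k] by (simp add: energy3_def s2_commute[of j i] algebra_simps)

lemma energy3_swap23: "energy3 i j k y = energy3 i k j y"
  using swap23[of i j k] by (simp add: energy3_def s2_commute[of k j] algebra_simps)

lemma energy4_swap34: "energy4 i j k l y = energy4 i j l k y"
  using swap23[of i j] swap23[of i k l] swap23[of j k l]
    by (simp add: energy4_def s2_commute[of k l] swap12[of k] algebra_simps)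

lemma energy4_swap23: "energy4 i j k l y = energy4 i k j l y"
  using swap23[of i j] swap12[of j k l]
    by (simp add: energy4_def s2_commute[of k j] algebra_simps)

lemma euler_s2: "(\<Sum>j\<in>UNIV. s2 i j y * y $ j) = 2 * s1 i y"
  by (simp add: s1_def)

lemma euler_s1: "(\<Sum>i\<in>UNIV. s1 i y * y $ i) = 3 * cub y"
  by (simp add: cub_def)

lemma croot_pow3: "croot y ^ 3 = cub y"
  by (simp add: croot_def odd_real_root_pow)

lemma croot_eq_0_iff: "croot y = 0 \<longleftrightarrow> cub y = 0"
  by (simp add: croot_def)

lemma euler_a: "(\<Sum>k\<in>UNIV. a i j k * y $ k) = s2 i j y"
  by (simp add: s2_def)

section \<open>Gradients of the cubic form and of its energy\<close>

lemma GDERIV_s2: "GDERIV (s2 i j) y :> (\<chi> l. a i j l)"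
proof -
  have "GDERIV (\<lambda>y. \<Sum>k\<in>UNIV. a i j k * y $ k) y
      :> (\<Sum>k\<in>UNIV. a i j k *\<^sub>R axis k 1 + (y $ k) *\<^sub>R 0)"
    by (intro GDERIV_sum GDERIV_mult GDERIV_const GDERIV_vec_nth)
  also have "(\<Sum>k\<in>UNIV. a i j k *\<^sub>R axis k 1 + (y $ k) *\<^sub>R 0) = (\<chi> l. a i j l)"
    by (simp add: vec_eq_iff axis_def if_distrib cong: if_cong)
  finally show ?thesis
    by (simp add: s2_def[abs_def])
qed

text \<open>By total symmetry the product rule yields \<open>s2 i l\<close> twice, and the divisor 2
  absorbs the doubling.\<close>

lemma GDERIV_s1: "GDERIV (s1 i) y :> (\<chi> l. s2 i l y)"
proof -
  have "GDERIV (\<lambda>y. (\<Sum>j\<in>UNIV. s2 i j y * y $ j) * (1 / 2)) y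
      :> (\<Sum>j\<in>UNIV. s2 i j y * y $ j) *\<^sub>R 0
         + (1 / 2) *\<^sub>R (\<Sum>j\<in>UNIV. s2 i j y *\<^sub>R axis j 1 + (y $ j) *\<^sub>R (\<chi> l. a i j l))"
    by (intro GDERIV_sum GDERIV_mult GDERIV_const GDERIV_vec_nth GDERIV_s2)
  also have "\<dots> = (\<chi> l. s2 i l y)"
  proof -
    have "(\<Sum>j\<in>UNIV. a i j l * y $ j) = s2 i l y" for l
      by (simp add: s2_def swap23[of i _ l])
    then show ?thesis
      by (simp add: vec_eq_iff axis_def if_distrib sum.distrib mult.commute cong: if_cong)
  qed
  finally show ?thesis
    by (simp add: s1_def[abs_def])
qed

lemma GDERIV_cub: "GDERIV cub y :> (\<chi> l. s1 l y)"
proof -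
  have "GDERIV (\<lambda>y. (\<Sum>i\<in>UNIV. s1 i y * y $ i) * (1 / 3)) y
      :> (\<Sum>i\<in>UNIV. s1 i y * y $ i) *\<^sub>R 0
         + (1 / 3) *\<^sub>R (\<Sum>i\<in>UNIV. s1 i y *\<^sub>R axis i 1 + (y $ i) *\<^sub>R (\<chi> l. s2 i l y))"
    by (intro GDERIV_sum GDERIV_mult GDERIV_const GDERIV_vec_nth GDERIV_s1)
  also have "\<dots> = (\<chi> l. s1 l y)"
  proof -
    have "(\<Sum>i\<in>UNIV. s2 i l y * y $ i) = 2 * s1 l y" for l
      by (simp add: euler_s2 s2_commute[of _ l])
    then show ?thesis
      by (simp add: vec_eq_iff axis_def if_distrib sum.distrib mult.commute cong: if_cong)
  qed
  finally show ?thesis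
    by (simp add: cub_def[abs_def])
qed

text \<open>The odd root is differentiable at nonzero arguments of either sign.\<close>

lemma GDERIV_croot:
  assumes "cub y \<noteq> 0"
  shows "GDERIV croot y :> (1 / (3 * croot y ^ 2)) *\<^sub>R (\<chi> l. s1 l y)"
proof -
  have "DERIV (root 3) (cub y) :> 1 / (3 * croot y ^ 2)"
    using DERIV_odd_real_root[of 3 "cub y"] assms
    by (simp add: croot_def inverse_eq_divide)
  from GDERIV_DERIV_compose[OF GDERIV_cub this] show ?thesis
    by (simp add: croot_def[abs_def])
qed

text \<open>The gradient of \<open>croot\<close> has \<open>croot y ^ 2\<close> in its denominator,
  so each differentiation raises the exponent by three: hence the powers 1, 4, 7, 10 in the
  energies.\<close>

lemma GDERIV_croot_neg_power:
  assumes "cub y \<noteq> 0"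
  shows "GDERIV (\<lambda>y. 1 / croot y ^ n) y :> (- real n / (3 * croot y ^ (n + 3))) *\<^sub>R (\<chi> l. s1 l y)"
proof -
  have "croot y \<noteq> 0"
    using assms by (simp add: croot_eq_0_iff)
  then have "- (real n * croot y ^ (n - Suc 0) * inverse ((croot y ^ n) ^ Suc (Suc 0))) = - real n / croot y ^ (n + 1)"
    \<comment> \<open>For \<open>n = 0\<close> the subtraction \<open>n - Suc 0\<close> truncates,
      but both sides are 0.\<close>
    by (cases n) (simp_all add: field_simps)
  then have "DERIV (\<lambda>x. 1 / x ^ n) (croot y) :> - real n / croot y ^ (n + 1)"
    using DERIV_inverse_fun[OF DERIV_pow[of n "croot y"]] \<open>croot y \<noteq> 0\<close>
    by (simp add: inverse_eq_divide)
  from GDERIV_DERIV_compose[OF GDERIV_croot[OF assms] this] show ?thesis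
    by (rule GDERIV_subst) (simp add: vec_eq_iff power_add power2_eq_square power3_eq_cube)
qed

lemma GDERIV_energy:
  assumes "cub y \<noteq> 0"
  shows "GDERIV (\<lambda>y. (croot y)\<^sup>2) y :> (\<chi> l. 2 * s1 l y / (3 * croot y))"
proof -
  have "croot y \<noteq> 0"
    using assms by (simp add: croot_eq_0_iff)
  then show ?thesis
    unfolding power2_eq_square
    by (intro GDERIV_subst[OF GDERIV_mult[OF GDERIV_croot[OF assms] GDERIV_croot[OF assms]]])
       (simp add: vec_eq_iff field_simps power2_eq_square)
qed

lemma GDERIV_energy_gradient:
  assumes "cub y \<noteq> 0"
  shows "GDERIV (\<lambda>y. s1 i y / (3 * croot y)) y :> (\<chi> l. energy2 i l y)"
proof -
  \<comment> \<open>Division becomes multiplication by \<open>1 / croot y ^ n\<close>, so that the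
    product rule and the preceding power rule suffice.\<close>
  have "GDERIV (\<lambda>y. s1 i y * (1 / 3) * (1 / croot y ^ 1)) y :> (\<chi> l. energy2 i l y)"
    by (rule GDERIV_subst,
        (rule GDERIV_mult GDERIV_const GDERIV_s1 GDERIV_croot_neg_power[OF assms])+)
       (simp add: vec_eq_iff energy2_def)
  then show ?thesis
    by (simp add: field_simps)
qed

lemma GDERIV_energy2:
  assumes "cub y \<noteq> 0"
  shows "GDERIV (energy2 i j) y :> (\<chi> l. energy3 i j l y)"
proof -
  have "GDERIV (\<lambda>y. s2 i j y * (1 / 3) * (1 / croot y ^ 1) - s1 i y * s1 j y * (1 / 9) * (1 / croot y ^ 4)) y
      :> (\<chi> l. energy3 i j l y)"
    by (rule GDERIV_subst,
        (rule GDERIV_diff GDERIV_mult GDERIV_const GDERIV_s1 GDERIV_s2 GDERIV_croot_neg_power[OF assms])+)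
       (simp add: vec_eq_iff energy3_def add_divide_distrib algebra_simps)
  then show ?thesis
    by (simp add: energy2_def[abs_def] mult.commute)
qed

lemma GDERIV_energy3:
  assumes "cub y \<noteq> 0"
  shows "GDERIV (energy3 i j k) y :> (\<chi> l. energy4 i j k l y)"
proof -
  have "GDERIV (\<lambda>y. a i j k * (1 / 3) * (1 / croot y ^ 1)
        - (s2 i j y * s1 k y + s2 i k y * s1 j y + s2 j k y * s1 i y) * (1 / 9) * (1 / croot y ^ 4)
        + 4 * (s1 i y * s1 j y * s1 k y) * (1 / 27) * (1 / croot y ^ 7)) y
      :> (\<chi> l. energy4 i j k l y)"
    by (rule GDERIV_subst,
        (rule GDERIV_diff GDERIV_add GDERIV_mult GDERIV_const GDERIV_s1 GDERIV_s2
          GDERIV_croot_neg_power[OF assms])+)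
       (simp add: vec_eq_iff energy4_def add_divide_distrib diff_divide_distrib algebra_simps)
  then show ?thesis
    by (simp add: energy3_def[abs_def] mult.commute)
qed

lemma euler_energy2:
  assumes "cub y \<noteq> 0"
  shows "(\<Sum>j\<in>UNIV. energy2 i j y * y $ j) = s1 i y / (3 * croot y)"
proof -
  have "croot y \<noteq> 0"
    using assms by (simp add: croot_eq_0_iff)
  have "(\<Sum>j\<in>UNIV. energy2 i j y * y $ j)
      = (\<Sum>j\<in>UNIV. s2 i j y * y $ j) / (3 * croot y) - s1 i y * (\<Sum>j\<in>UNIV. s1 j y * y $ j) / (9 * croot y ^ 4)"
    by (simp add: energy2_def left_diff_distrib sum_subtractf sum_divide_distrib sum_distrib_left mult.assoc)
  also have "\<dots> = s1 i y / (3 * croot y)"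
    using \<open>croot y \<noteq> 0\<close> by (simp add: euler_s2 euler_s1 flip: croot_pow3) (simp add: field_simps eval_nat_numeral)
  finally show ?thesis .
qed

text \<open>The metric \<open>energy2\<close> is homogeneous of degree 0, so the Euler field
  annihilates it; this is the source of \<open>cartan_G_eq\<close>.\<close>

lemma euler_energy3:
  assumes "cub y \<noteq> 0"
  shows "(\<Sum>k\<in>UNIV. energy3 i j k y * y $ k) = 0"
proof -
  have "croot y \<noteq> 0"
    using assms by (simp add: croot_eq_0_iff)
  have "(\<Sum>k\<in>UNIV. energy3 i j k y * y $ k)
      = (\<Sum>k\<in>UNIV. a i j k * y $ k) / (3 * croot y)
        - (s2 i j y * (\<Sum>k\<in>UNIV. s1 k y * y $ k) + s1 j y * (\<Sum>k\<in>UNIV. s2 i k y * y $ k)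
          + s1 i y * (\<Sum>k\<in>UNIV. s2 j k y * y $ k)) / (9 * croot y ^ 4)
        + 4 * (s1 i y * s1 j y * (\<Sum>k\<in>UNIV. s1 k y * y $ k)) / (27 * croot y ^ 7)"
    by (simp add: energy3_def algebra_simps add_divide_distrib diff_divide_distrib sum_subtractf sum.distrib
        sum_divide_distrib sum_distrib_left)
  also have "\<dots> = 0"
    using \<open>croot y \<noteq> 0\<close>
    by (simp add: euler_a euler_s2 euler_s1 flip: croot_pow3) (simp add: field_simps eval_nat_numeral)
  finally show ?thesis .
qed

text \<open>Euler's identity for \<open>energy3\<close>, which is homogeneous of degree -1.\<close>

lemma euler_energy4:
  assumes "cub y \<noteq> 0"
  shows "(\<Sum>l\<in>UNIV. energy4 i j k l y * y $ l) = - energy3 i j k y"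
proof -
  have "croot y \<noteq> 0"
    using assms by (simp add: croot_eq_0_iff)
  have "(\<Sum>l\<in>UNIV. energy4 i j k l y * y $ l) =
     - (a i j k * (\<Sum>l\<in>UNIV. s1 l y * y $ l) + s1 k y * (\<Sum>l\<in>UNIV. a i j l * y $ l)
        + s1 j y * (\<Sum>l\<in>UNIV. a i k l * y $ l) + s1 i y * (\<Sum>l\<in>UNIV. a j k l * y $ l)
        + s2 i j y * (\<Sum>l\<in>UNIV. s2 k l y * y $ l) + s2 i k y * (\<Sum>l\<in>UNIV. s2 j l y * y $ l)
        + s2 j k y * (\<Sum>l\<in>UNIV. s2 i l y * y $ l)) / (9 * croot y ^ 4)
     + 4 * ((s2 i j y * s1 k y + s2 i k y * s1 j y + s2 j k y * s1 i y) * (\<Sum>l\<in>UNIV. s1 l y * y $ l)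
        + s1 j y * s1 k y * (\<Sum>l\<in>UNIV. s2 i l y * y $ l)
        + s1 i y * s1 k y * (\<Sum>l\<in>UNIV. s2 j l y * y $ l)
        + s1 i y * s1 j y * (\<Sum>l\<in>UNIV. s2 k l y * y $ l)) / (27 * croot y ^ 7)
     - 28 * (s1 i y * s1 j y * s1 k y * (\<Sum>l\<in>UNIV. s1 l y * y $ l)) / (81 * croot y ^ 10)"
    by (simp add: energy4_def algebra_simps add_divide_distrib diff_divide_distrib sum_subtractf sum.distrib
        sum_negf sum_divide_distrib sum_distrib_left)
  also have "\<dots> = - energy3 i j k y"
    using \<open>croot y \<noteq> 0\<close>
    by (simp add: energy3_def euler_a euler_s2 euler_s1 flip: croot_pow3) (simp add: field_simps eval_nat_numeral)
  finally show ?thesis .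
qed

section \<open>Nondegeneracy of the metric and its Christoffel symbols\<close>

definition regular :: "real^'n \<Rightarrow> bool" where
  "regular y \<longleftrightarrow> cub y \<noteq> 0 \<and> invertible (\<chi> i j. s2 i j y)"

text \<open>
  If \<open>v\<close> is in the kernel of \<open>energy2\<close>, contracting with \<open>y\<close> gives \<open>s1 \<bullet> v = 0\<close> by Euler's identity,
  and then \<open>v\<close> is in the kernel of \<open>s2\<close>.
\<close>

lemma energy2_injective:
  assumes "regular y" and zero: "\<And>i. (\<Sum>j\<in>UNIV. energy2 i j y * v j) = 0"
  shows "v j = 0"
proof -
  have cub: "cub y \<noteq> 0" and inv: "invertible (\<chi> i j. s2 i j y)"
    using assms(1) by (auto simp: regular_def)
  then have croot: "croot y \<noteq> 0"
    by (simp add: croot_eq_0_iff)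
  have "0 = (\<Sum>i\<in>UNIV. (\<Sum>j\<in>UNIV. energy2 i j y * v j) * y $ i)"
    using zero by simp
  also have "\<dots> = (\<Sum>j\<in>UNIV. (\<Sum>i\<in>UNIV. energy2 i j y * y $ i) * v j)"
    by (simp only: sum_distrib_right, subst sum.swap) (simp add: mult_ac)
  also have "\<dots> = (\<Sum>j\<in>UNIV. (\<Sum>i\<in>UNIV. energy2 j i y * y $ i) * v j)"
    by (simp only: energy2_commute)
  also have "\<dots> = (\<Sum>j\<in>UNIV. s1 j y * v j) / (3 * croot y)"
    by (simp add: euler_energy2[OF cub] sum_divide_distrib)
  finally have orth: "(\<Sum>j\<in>UNIV. s1 j y * v j) = 0"
    using croot by simp
  have "(\<Sum>j\<in>UNIV. s2 i j y * v j) = 0" for i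
  proof -
    have "0 = (\<Sum>j\<in>UNIV. energy2 i j y * v j)"
      using zero by simp
    also have "\<dots> = (\<Sum>j\<in>UNIV. s2 i j y * v j) / (3 * croot y)
        - s1 i y * (\<Sum>j\<in>UNIV. s1 j y * v j) / (9 * croot y ^ 4)"
      by (simp add: energy2_def left_diff_distrib sum_subtractf sum_divide_distrib sum_distrib_left mult.assoc)
    finally show ?thesis
      using orth croot by simp
  qed
  then have "(\<chi> i j. s2 i j y) *v (\<chi> j. v j) = 0"
    by (simp add: matrix_vector_mult_def vec_eq_iff)
  then have "(\<chi> j. v j) = 0"
    using inv matrix_left_invertible_ker invertible_left_inverse by blast
  then show ?thesis
    by (simp add: vec_eq_iff)
qed

lemma invertible_energy2:
  assumes "regular y"
  shows "invertible (\<chi> i j. energy2 i j y)"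
proof -
  have "v = 0" if "(\<chi> i j. energy2 i j y) *v v = 0" for v
    using energy2_injective[OF assms, of "\<lambda>j. v $ j"] that
    by (simp add: matrix_vector_mult_def vec_eq_iff)
  then show ?thesis
    using matrix_left_invertible_ker invertible_left_inverse by blast
qed

text \<open>Total symmetry of \<open>energy3\<close> collapses the usual three-term combination of
  first derivatives of the metric to a single term.\<close>

definition christoffel :: "'n \<Rightarrow> 'n \<Rightarrow> 'n \<Rightarrow> real^'n \<Rightarrow> real" where
  "christoffel i j k y = (\<Sum>m\<in>UNIV. matrix_inv (\<chi> a b. energy2 a b y) $ i $ m / 2 * energy3 j k m y)"

lemma energy2_christoffel_vec:
  assumes "regular y"
  shows "(\<chi> i j. energy2 i j y) *v (\<chi> m. christoffel m j k y) = (\<chi> l. energy3 j k l y / 2)"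
proof -
  let ?g = "\<chi> i j. energy2 i j y"
  have "(\<chi> m. christoffel m j k y) = matrix_inv ?g *v (\<chi> l. energy3 j k l y / 2)"
    by (simp add: christoffel_def matrix_vector_mult_def vec_eq_iff)
  then show ?thesis
    \<comment> \<open>\<open>matrix_inv\<close> is a Hilbert choice; invertibility certifies it as a
      two-sided inverse.\<close>
    using someI_ex[OF invertible_energy2[OF assms, unfolded invertible_def], folded matrix_inv_def]
    by (simp add: matrix_vector_mul_assoc)
qed

lemma energy2_christoffel:
  assumes "regular y"
  shows "(\<Sum>m\<in>UNIV. energy2 l m y * christoffel m j k y) = energy3 j k l y / 2"
  using energy2_christoffel_vec[OF assms, of j k] by (simp add: matrix_vector_mult_def vec_eq_iff)

text \<open>A quotient of determinants can be differentiated without differentiating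
  \<open>matrix_inv\<close>.\<close>

lemma christoffel_cramer:
  assumes "regular y"
  shows "christoffel m j k y =
    det (\<chi> i n. if n = m then energy3 j k i y / 2 else energy2 i n y) / det (\<chi> i n. energy2 i n y)"
proof -
  let ?g = "\<chi> i n. energy2 i n y" and ?b = "\<chi> l. energy3 j k l y / 2"
  have "(\<chi> m. christoffel m j k y) = (\<chi> m. det (\<chi> i n. if n = m then ?b $ i else ?g $ i $ n) / det ?g)"
    by (rule iffD1[OF cramer energy2_christoffel_vec[OF assms]])
       (rule invertible_energy2[OF assms, unfolded invertible_det_nz])
  from arg_cong[OF this, of "\<lambda>v. v $ m"] show ?thesis
    by (simp cong: if_cong)
qed

lemma continuous_cub: "continuous_on UNIV cub"
  by (rule continuous_on_differentiable) (rule GDERIV_differentiable[OF GDERIV_cub])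

text \<open>Openness allows identities known at regular points to be differentiated there.\<close>

lemma open_regular: "open {y. regular y}"
proof -
  have "continuous_on UNIV (\<lambda>y. det (\<chi> i j. s2 i j y))"
    by (rule continuous_on_differentiable, rule differentiable_det)
       (simp add: GDERIV_differentiable[OF GDERIV_s2])
  then have "open ({y. cub y \<noteq> 0} \<inter> {y. det (\<chi> i j. s2 i j y) \<noteq> 0})"
    using continuous_cub by (intro open_Int open_Collect_neq continuous_on_const)
  then show ?thesis
    by (simp add: regular_def invertible_det_nz Collect_conj_eq)
qed

lemma differentiable_christoffel:
  assumes "regular y"
  shows "christoffel m j k differentiable (at y)"
proof -
  have cub: "cub y \<noteq> 0"
    using assms by (simp add: regular_def)
  let ?f = "\<lambda>y. det (\<chi> i n. if n = m then energy3 j k i y * (1 / 2) else energy2 i n y) / det (\<chi> i n. energy2 i n y)"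
  have "(\<lambda>y. if n = m then energy3 j k i y * (1 / 2) else energy2 i n y) differentiable (at y)" for i n
    using GDERIV_differentiable[OF GDERIV_energy3[OF cub]] GDERIV_differentiable[OF GDERIV_energy2[OF cub]]
    by (cases "n = m") (auto intro!: differentiable_mult)
  then have "?f differentiable (at y)"
    using invertible_energy2[OF assms] GDERIV_differentiable[OF GDERIV_energy2[OF cub]]
    by (intro differentiable_divide differentiable_det) (auto simp: invertible_det_nz)
  then show ?thesis
    by (rule differentiable_transform_open[OF _ open_regular])
       (use assms in \<open>simp_all add: christoffel_cramer cong: if_cong\<close>)
qed

text \<open>Taken abstractly, with no closed formula; since the metric is nondegenerate, the lowered
  form in \<open>energy2_dchristoffel\<close> determines it at regular points.\<close>

definition dchristoffel :: "'n \<Rightarrow> 'n \<Rightarrow> 'n \<Rightarrow> 'n \<Rightarrow> real^'n \<Rightarrow> real" where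
  "dchristoffel i j k l y = frechet_derivative (christoffel i j k) (at y) (axis l 1)"

lemma GDERIV_christoffel:
  assumes "regular y"
  shows "GDERIV (christoffel i j k) y :> (\<chi> l. dchristoffel i j k l y)"
proof -
  let ?D = "frechet_derivative (christoffel i j k) (at y)"
  have D: "(christoffel i j k has_derivative ?D) (at y)"
    using differentiable_christoffel[OF assms] frechet_derivative_works by blast
  have "?D v = v \<bullet> (\<chi> l. dchristoffel i j k l y)" for v
  proof -
    have "?D v = ?D (\<Sum>l\<in>UNIV. (v $ l) *\<^sub>R axis l 1)"
      using basis_expansion[of v] by (simp add: scalar_mult_eq_scaleR)
    also have "\<dots> = (\<Sum>l\<in>UNIV. v $ l * ?D (axis l 1))"
      using has_derivative_linear[OF D] by (simp add: linear_sum linear_scale)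
    finally show ?thesis
      by (simp add: inner_vec_def dchristoffel_def)
  qed
  then show ?thesis
    unfolding gderiv_def using D by presburger
qed

text \<open>Both sides of \<open>energy2_christoffel\<close> are differentiated near
  \<open>y\<close>, the left one by the product rule, and the gradients are compared in direction
  \<open>axis k 1\<close>.\<close>

lemma energy2_dchristoffel:
  assumes "regular y"
  shows "(\<Sum>m\<in>UNIV. energy2 n m y * dchristoffel m i j k y)
    = energy4 i j n k y / 2 - (\<Sum>m\<in>UNIV. energy3 n m k y * christoffel m i j y)"
proof -
  have cub: "cub y \<noteq> 0"
    using assms by (simp add: regular_def)
  have 1: "GDERIV (\<lambda>y. \<Sum>m\<in>UNIV. energy2 n m y * christoffel m i j y) y
      :> (\<Sum>m\<in>UNIV. energy2 n m y *\<^sub>R (\<chi> l. dchristoffel m i j l y) + christoffel m i j y *\<^sub>R (\<chi> l. energy3 n m l y))"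
    by (intro GDERIV_sum GDERIV_mult GDERIV_energy2 GDERIV_christoffel cub assms)
  have "GDERIV (\<lambda>y. energy3 i j n y * (1 / 2)) y :> energy3 i j n y *\<^sub>R 0 + (1 / 2) *\<^sub>R (\<chi> l. energy4 i j n l y)"
    by (intro GDERIV_mult GDERIV_energy3 GDERIV_const cub)
  then have 2: "GDERIV (\<lambda>y. \<Sum>m\<in>UNIV. energy2 n m y * christoffel m i j y) y
      :> energy3 i j n y *\<^sub>R 0 + (1 / 2) *\<^sub>R (\<chi> l. energy4 i j n l y)"
    unfolding gderiv_def
    by (rule has_derivative_transform_within_open[OF _ open_regular]) (auto simp: assms energy2_christoffel)
  have "(\<lambda>v. v \<bullet> (\<Sum>m\<in>UNIV. energy2 n m y *\<^sub>R (\<chi> l. dchristoffel m i j l y) + christoffel m i j y *\<^sub>R (\<chi> l. energy3 n m l y)))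
      = (\<lambda>v. v \<bullet> (energy3 i j n y *\<^sub>R 0 + (1 / 2) *\<^sub>R (\<chi> l. energy4 i j n l y)))"
    using 1 2 unfolding gderiv_def by (rule has_derivative_unique)
  from fun_cong[OF this, of "axis k 1"] show ?thesis
    by (simp add: inner_axis' sum.distrib mult.commute)
qed

text \<open>Homogeneity of degree -1, checked after lowering the upper index:
  \<open>euler_energy4\<close> gives the right multiple of \<open>energy3\<close>,
  \<open>euler_energy3\<close> removes the product term, and \<open>energy2_injective\<close> strips
  off the metric.\<close>

lemma euler_christoffel:
  assumes "regular y"
  shows "(\<Sum>k\<in>UNIV. dchristoffel m i j k y * y $ k) = - christoffel m i j y"
proof -
  have cub: "cub y \<noteq> 0"
    using assms by (simp add: regular_def)
  have "(\<Sum>m\<in>UNIV. energy2 n m y * ((\<Sum>k\<in>UNIV. dchristoffel m i j k y * y $ k) + christoffel m i j y)) = 0" for n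
  proof -
    have "(\<Sum>m\<in>UNIV. energy2 n m y * (\<Sum>k\<in>UNIV. dchristoffel m i j k y * y $ k))
        = (\<Sum>k\<in>UNIV. (\<Sum>m\<in>UNIV. energy2 n m y * dchristoffel m i j k y) * y $ k)"
      by (simp only: sum_distrib_left sum_distrib_right mult.assoc) (rule sum.swap)
    also have "\<dots> = (\<Sum>k\<in>UNIV. energy4 i j n k y * y $ k) / 2
        - (\<Sum>k\<in>UNIV. \<Sum>m\<in>UNIV. energy3 n m k y * christoffel m i j y * y $ k)"
      by (simp add: energy2_dchristoffel[OF assms] left_diff_distrib sum_subtractf sum_divide_distrib sum_distrib_right)
    also have "(\<Sum>k\<in>UNIV. \<Sum>m\<in>UNIV. energy3 n m k y * christoffel m i j y * y $ k)
        = (\<Sum>m\<in>UNIV. christoffel m i j y * (\<Sum>k\<in>UNIV. energy3 n m k y * y $ k))"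
      by (subst sum.swap) (simp add: sum_distrib_left mult_ac)
    finally show ?thesis
      by (simp add: distrib_left sum.distrib energy2_christoffel[OF assms] euler_energy3[OF cub] euler_energy4[OF cub])
  qed
  from energy2_injective[OF assms this] show ?thesis
    by (simp add: eq_neg_iff_add_eq_0)
qed

text \<open>The Levi-Civita curvature of \<open>energy2\<close>, with the index order of
  \<open>S_vv\<close>.\<close>

definition curv :: "'n \<Rightarrow> 'n \<Rightarrow> 'n \<Rightarrow> 'n \<Rightarrow> real^'n \<Rightarrow> real" where
  "curv l i j k y = dchristoffel l i j k y - dchristoffel l i k j y
     + (\<Sum>m\<in>UNIV. christoffel m i j y * christoffel l m k y) - (\<Sum>m\<in>UNIV. christoffel m i k y * christoffel l m j y)"

text \<open>The fourth derivatives cancel in the lowered curvature because they are symmetric.\<close>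

lemma energy2_curv:
  assumes "regular y"
  shows "(\<Sum>l\<in>UNIV. energy2 n l y * curv l i j k y)
    = ((\<Sum>m\<in>UNIV. energy3 n m j y * christoffel m i k y) - (\<Sum>m\<in>UNIV. energy3 n m k y * christoffel m i j y)) / 2"
proof -
  have quad: "(\<Sum>l\<in>UNIV. energy2 n l y * (\<Sum>m\<in>UNIV. christoffel m i j y * christoffel l m k y))
      = (\<Sum>m\<in>UNIV. energy3 n m k y * christoffel m i j y) / 2" for j k
  proof -
    have "(\<Sum>l\<in>UNIV. energy2 n l y * (\<Sum>m\<in>UNIV. christoffel m i j y * christoffel l m k y))
        = (\<Sum>m\<in>UNIV. christoffel m i j y * (\<Sum>l\<in>UNIV. energy2 n l y * christoffel l m k y))"
      by (subst sum_distrib_left, subst sum.swap) (simp add: sum_distrib_left mult_ac)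
    also have "\<dots> = (\<Sum>m\<in>UNIV. energy3 n m k y * christoffel m i j y) / 2"
    proof -
      have "energy3 m k n y = energy3 n m k y" for m
        using energy3_swap23[of m k n y] energy3_swap12[of m n k y] by simp
      then show ?thesis
        by (simp add: energy2_christoffel[OF assms] sum_divide_distrib mult.commute)
    qed
    finally show ?thesis .
  qed
  have "(\<Sum>l\<in>UNIV. energy2 n l y * curv l i j k y)
      = (\<Sum>l\<in>UNIV. energy2 n l y * dchristoffel l i j k y) - (\<Sum>l\<in>UNIV. energy2 n l y * dchristoffel l i k j y)
        + (\<Sum>l\<in>UNIV. energy2 n l y * (\<Sum>m\<in>UNIV. christoffel m i j y * christoffel l m k y))
        - (\<Sum>l\<in>UNIV. energy2 n l y * (\<Sum>m\<in>UNIV. christoffel m i k y * christoffel l m j y))"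
    by (simp add: curv_def distrib_left right_diff_distrib sum.distrib sum_subtractf)
  moreover have "energy4 i j n k y = energy4 i k n j y"
    using energy4_swap34[of i j n k y] energy4_swap23[of i j k n y] energy4_swap34[of i k j n y] by simp
  \<comment> \<open>Each product of \<open>energy3\<close> and \<open>christoffel\<close> occurs
    with coefficient -1 or 1 from the derivatives and with half of the opposite from the quadratic
    terms.\<close>
  ultimately show ?thesis
    by (simp add: energy2_dchristoffel[OF assms] quad)
qed

end

section \<open>Curvature of the connection in its adapted frame\<close>

lemma act_eqI: "(f has_derivative D) (at p) \<Longrightarrow> act X f p = D (X p)"
  unfolding act_def using frechet_derivative_at by metis

text \<open>The two functions have the same derivatives at \<open>p\<close>, so the choice in
  \<open>frechet_derivative\<close> agrees for them, differentiable or not. This transfers closed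
  forms valid only on an open set.\<close>

lemma act_cong_open:
  assumes "open S" "p \<in> S" "\<And>q. q \<in> S \<Longrightarrow> f q = g q"
  shows "act X f p = act X g p"
proof -
  have "(f has_derivative D) (at p) \<longleftrightarrow> (g has_derivative D) (at p)" for D
    using has_derivative_transform_within_open[of f D p UNIV S g]
      has_derivative_transform_within_open[of g D p UNIV S f] assms by auto
  then show ?thesis
    unfolding act_def frechet_derivative_def by simp
qed

lemma has_derivative_vel:
  assumes "GDERIV f (vel p) :> D"
  shows "((\<lambda>q. f (vel q)) has_derivative (\<lambda>v. vel v \<bullet> D)) (at p)"
proof -
  have "((\<lambda>q. vel q) has_derivative (\<lambda>v. vel v)) (at p)"
    by (auto intro!: derivative_eq_intros)
  then show ?thesis
    by (rule has_derivative_compose) (rule assms[unfolded gderiv_def])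
qed

lemma act_vel:
  assumes "GDERIV f (vel p) :> D"
  shows "act X (\<lambda>q. f (vel q)) p = vel (X p) \<bullet> D"
  using has_derivative_vel[OF assms] by (rule act_eqI)

lemma has_derivative_time:
  assumes "DERIV c (time p) :> c'"
  shows "((\<lambda>q. c (time q)) has_derivative (\<lambda>v. c' * time v)) (at p)"
proof -
  have "((\<lambda>q. time q) has_derivative (\<lambda>v. time v)) (at p)"
    by (auto intro!: derivative_eq_intros)
  then show ?thesis
    by (rule has_derivative_compose) (rule assms[unfolded has_field_derivative_def])
qed

lemma sum_axis_mult: "(\<Sum>k\<in>UNIV. axis l 1 $ k * f k) = (f l :: real)"
proof -
  have "axis l 1 $ k * f k = (if k = l then f k else 0)" for k
    by (simp add: axis_def)
  then show ?thesis by simp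
qed

lemma act_time_mult_vel:
  assumes "DERIV c (time p) :> c'" "GDERIV f (vel p) :> D"
  shows "act X (\<lambda>q. c (time q) * f (vel q)) p
    = c' * time (X p) * f (vel p) + c (time p) * (vel (X p) \<bullet> D)"
  using act_eqI[OF has_derivative_mult[OF has_derivative_time[OF assms(1)] has_derivative_vel[OF assms(2)]], of X]
  by simp

text \<open>Collects the coefficients of the connection on horizontal fields, so that one curvature
  formula serves all five d-tensors.\<close>

fun conn :: "(real \<Rightarrow> real) \<Rightarrow> adapted_index \<Rightarrow> 4 \<Rightarrow> 4 \<Rightarrow> jet \<Rightarrow> real" where
  "conn h Temporal k i = cartan_G h k i"
| "conn h (Horizontal j) k i = cartan_L h k i j"
| "conn h (Vertical j) k i = cartan_C h k i j"

lemma cartan_table_horizontal: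
  "cartan_table h a (Horizontal i) p = (\<Sum>k\<in>UNIV. conn h a k i p *\<^sub>R delta_x h k p)"
  by (cases a) simp_all

lemma coframe_delta_x: "coframe h a p (delta_x h i p) = (if a = Horizontal i then 1 else 0)"
  using coframe_frame[of h a p "Horizontal i"] by simp

lemma coframe_delta_x_sum:
  "coframe h a p (\<Sum>k\<in>UNIV. c k *\<^sub>R delta_x h k p) = (case a of Horizontal l \<Rightarrow> c l | _ \<Rightarrow> 0)"
  by (cases a)
     (simp_all add: linear_sum[OF linear_coframe] linear_scale[OF linear_coframe] coframe_delta_x
       if_distrib cong: if_cong del: coframe.simps)

text \<open>The frame components of \<open>delta_x h i\<close> are constant, which leaves only
  connection terms. \<open>X\<close> is arbitrary because it will be a Lie bracket.\<close>

lemma coframe_nabla_delta_x: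
  "coframe h (Horizontal l) p (nabla h X (delta_x h i) p)
    = (\<Sum>a\<in>UNIV. coframe h a p (X p) * conn h a l i p)"
proof -
  have "(c * (if b = Horizontal i then 1 else 0)) *\<^sub>R v = (if b = Horizontal i then c *\<^sub>R v else 0)"
    for c :: real and v :: jet and b
    by simp
  then have "nabla h X (delta_x h i) p
      = (\<Sum>a\<in>UNIV. coframe h a p (X p) *\<^sub>R cartan_table h a (Horizontal i) p)"
    by (simp add: nabla_def act_const coframe_delta_x del: coframe.simps)
  then show ?thesis
    by (simp add: linear_sum[OF linear_coframe] linear_scale[OF linear_coframe] cartan_table_horizontal
        coframe_delta_x if_distrib cong: if_cong del: coframe.simps)
qed

lemma coframe_nabla_delta_x_combination:
  "coframe h (Horizontal l) p (nabla h (frame h a) (\<lambda>q. \<Sum>k\<in>UNIV. c k q *\<^sub>R delta_x h k q) p)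
    = act (frame h a) (c l) p + (\<Sum>m\<in>UNIV. c m p * conn h a l m p)"
proof -
  let ?Z = "\<lambda>q. \<Sum>k\<in>UNIV. c k q *\<^sub>R delta_x h k q"
  have "nabla h (frame h a) ?Z p = (\<Sum>k\<in>UNIV. act (frame h a) (c k) p *\<^sub>R delta_x h k p)
      + (\<Sum>a'\<in>UNIV. if a' = a then (\<Sum>k\<in>UNIV. c k p *\<^sub>R cartan_table h a' (Horizontal k) p) else 0)"
    unfolding nabla_def coframe_delta_x_sum coframe_frame
    by (intro arg_cong2[where f="(+)"] sum.cong refl) (auto simp: sum_adapted_index act_const)
  then show ?thesis
    by (simp add: linear_add[OF linear_coframe] linear_sum[OF linear_coframe]
        linear_scale[OF linear_coframe] cartan_table_horizontal
        coframe_delta_x if_distrib cong: if_cong del: coframe.simps)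
qed

text \<open>The inner covariant derivative is a combination of horizontal fields with coefficients
  \<open>conn\<close>, to which the Leibniz rule applies.\<close>

lemma coframe_curvature_frame:
  "coframe h (Horizontal l) p (curvature h (frame h a) (frame h b) (delta_x h i) p)
    = act (frame h a) (conn h b l i) p - act (frame h b) (conn h a l i) p
      + (\<Sum>m\<in>UNIV. conn h b m i p * conn h a l m p) - (\<Sum>m\<in>UNIV. conn h a m i p * conn h b l m p)
      - (\<Sum>c\<in>UNIV. coframe h c p (lie_bracket (frame h a) (frame h b) p) * conn h c l i p)"
proof -
  have "nabla h (frame h c) (delta_x h i) = (\<lambda>q. \<Sum>k\<in>UNIV. conn h c k i q *\<^sub>R delta_x h k q)" for c
    using nabla_frame[of h c "Horizontal i"] by (auto simp: cartan_table_horizontal)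
  then show ?thesis
    by (simp add: curvature_def linear_diff[OF linear_coframe] coframe_nabla_delta_x
        coframe_nabla_delta_x_combination del: coframe.simps)
qed

text \<open>Brackets of \<open>delta_x h k\<close> or \<open>partial_y k\<close> with
  \<open>delta_t h\<close> are of this form.\<close>

lemma coframe_curvature_frame_vertical_bracket:
  assumes "lie_bracket (frame h a) (frame h b) p = \<beta> *\<^sub>R partial_y k p"
  shows "coframe h (Horizontal l) p (curvature h (frame h a) (frame h b) (delta_x h i) p)
    = act (frame h a) (conn h b l i) p - act (frame h b) (conn h a l i) p
      + (\<Sum>m\<in>UNIV. conn h b m i p * conn h a l m p) - (\<Sum>m\<in>UNIV. conn h a m i p * conn h b l m p)
      - \<beta> * cartan_C h l i k p"
proof -
  have "coframe h c p (\<beta> *\<^sub>R partial_y k p) = (if c = Vertical k then \<beta> else 0)" for c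
    using coframe_frame[of h c p "Vertical k"] by (simp add: linear_scale[OF linear_coframe] del: coframe.simps)
  then show ?thesis
    unfolding coframe_curvature_frame assms by (simp add: if_distrib[of "\<lambda>x. x * _"] cong: if_cong)
qed

lemma coframe_curvature_frame_commuting:
  assumes "lie_bracket (frame h a) (frame h b) p = 0"
  shows "coframe h (Horizontal l) p (curvature h (frame h a) (frame h b) (delta_x h i) p)
    = act (frame h a) (conn h b l i) p - act (frame h b) (conn h a l i) p
      + (\<Sum>m\<in>UNIV. conn h b m i p * conn h a l m p) - (\<Sum>m\<in>UNIV. conn h a m i p * conn h b l m p)"
  unfolding coframe_curvature_frame assms
  by (simp add: linear_0[OF linear_coframe] del: coframe.simps)

section \<open>Lie brackets of the adapted frame\<close>

lemma act_partial_y: "act X (partial_y j) p = 0"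
  by (rule act_eqI) (simp add: partial_y_def[abs_def])

lemma lie_bracket_partial_y_partial_y: "lie_bracket (partial_y k) (partial_y j) p = 0"
  by (simp add: lie_bracket_def act_partial_y)

lemma S_vv_eq:
  "S_vv h l i j k p =
     act (partial_y k) (cartan_C h l i j) p - act (partial_y j) (cartan_C h l i k) p
     + (\<Sum>m\<in>UNIV. cartan_C h m i j p * cartan_C h l m k p)
     - (\<Sum>m\<in>UNIV. cartan_C h m i k p * cartan_C h l m j p)"
  using coframe_curvature_frame_commuting[of h "Vertical k" "Vertical j" p l i,
      unfolded frame.simps, OF lie_bracket_partial_y_partial_y]
  by (simp add: S_vv_def del: coframe.simps)

lemma temporal_metric_DERIV:
  assumes "temporal_metric h"
  shows "DERIV h t :> deriv h t"
proof -
  have "((deriv ^^ 0) h) differentiable (at t)"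
    using assms unfolding temporal_metric_def by blast
  then show ?thesis
    by (simp add: DERIV_deriv_iff_real_differentiable)
qed

lemma temporal_metric_DERIV_kappa:
  assumes "temporal_metric h"
  shows "DERIV (kappa h) t :> deriv (kappa h) t"
proof -
  \<comment> \<open>\<open>kappa\<close> contains \<open>deriv h\<close>, so its derivative requires
    the second derivative of \<open>h\<close>.\<close>
  have "((deriv ^^ 1) h) differentiable (at t)"
    using assms unfolding temporal_metric_def by blast
  moreover have "h differentiable (at t)"
    using temporal_metric_DERIV[OF assms] real_differentiable_def by blast
  moreover have "h t \<noteq> 0"
    using assms unfolding temporal_metric_def by (metis less_irrefl)
  ultimately have "kappa h differentiable (at t)"
    unfolding kappa_def[abs_def] by (intro differentiable_mult differentiable_divide) auto
  then show ?thesis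
    by (simp add: DERIV_deriv_iff_real_differentiable)
qed

lemma act_delta_x:
  assumes "temporal_metric h"
  shows "act X (delta_x h j) p = (0, 0, (deriv (kappa h) (time p) * time (X p) / 2) *\<^sub>R axis j 1)"
proof -
  note [derivative_intros] = has_derivative_time[OF temporal_metric_DERIV_kappa[OF assms]]
  have "(delta_x h j has_derivative
      (\<lambda>v. (0, 0, (deriv (kappa h) (time p) * time v / 2) *\<^sub>R axis j 1))) (at p)"
    unfolding delta_x_eq[abs_def]
    by (auto intro!: derivative_eq_intros)
  then show ?thesis
    by (rule act_eqI)
qed

lemma act_delta_t:
  assumes "temporal_metric h"
  shows "act X (delta_t h) p
    = (0, 0, (deriv (kappa h) (time p) * time (X p)) *\<^sub>R vel p + kappa h (time p) *\<^sub>R vel (X p))"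
proof -
  note [derivative_intros] = has_derivative_time[OF temporal_metric_DERIV_kappa[OF assms]]
  have "(delta_t h has_derivative
      (\<lambda>v. (0, 0, (deriv (kappa h) (time p) * time v) *\<^sub>R vel p + kappa h (time p) *\<^sub>R vel v))) (at p)"
    unfolding delta_t_eq[abs_def]
    by (auto intro!: derivative_eq_intros)
  then show ?thesis
    by (rule act_eqI)
qed

text \<open>The coefficients of these fields depend on time only, and the fields have no time
  component.\<close>

lemma lie_bracket_delta_x_delta_x:
  assumes "temporal_metric h"
  shows "lie_bracket (delta_x h k) (delta_x h j) p = 0"
  by (simp add: lie_bracket_def act_delta_x[OF assms] delta_x_eq zero_prod_def)

lemma lie_bracket_partial_y_delta_x:
  assumes "temporal_metric h"
  shows "lie_bracket (partial_y k) (delta_x h j) p = 0"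
  by (simp add: lie_bracket_def act_delta_x[OF assms] act_partial_y partial_y_def zero_prod_def)

lemma lie_bracket_delta_x_delta_t:
  assumes "temporal_metric h"
  shows "lie_bracket (delta_x h k) (delta_t h) p
    = (((kappa h (time p))\<^sup>2 - deriv (kappa h) (time p)) / 2) *\<^sub>R partial_y k p"
  by (simp add: lie_bracket_def act_delta_x[OF assms] act_delta_t[OF assms] delta_x_eq delta_t_eq
      partial_y_def zero_prod_def scaleR_diff_left diff_divide_distrib power2_eq_square)

lemma lie_bracket_partial_y_delta_t:
  assumes "temporal_metric h"
  shows "lie_bracket (partial_y k) (delta_t h) p = kappa h (time p) *\<^sub>R partial_y k p"
  by (simp add: lie_bracket_def act_partial_y act_delta_t[OF assms] partial_y_def)

section \<open>The Chernov metric\<close>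

text \<open>Each monomial of the third elementary symmetric polynomial arises from six index orders,
  cancelling the overall factor 1/6 in \<open>cub\<close>.\<close>

definition chernov_coeff :: "4 \<Rightarrow> 4 \<Rightarrow> 4 \<Rightarrow> real" where
  "chernov_coeff i j k = (if i \<noteq> j \<and> j \<noteq> k \<and> i \<noteq> k then 1 else 0)"

interpretation chernov: symmetric_cubic chernov_coeff
  by unfold_locales (auto simp: chernov_coeff_def)

lemma S3_eq: "S3 = (\<lambda>p. chernov.cub (vel p))"
  by (simp add: fun_eq_iff S3_def Let_def chernov.cub_def chernov.s1_def chernov.s2_def sum_4
      chernov_coeff_def field_simps)

lemma hessian_S3_eq: "hessian_S3 p = (\<chi> i j. chernov.s2 i j (vel p))"
proof -
  have "act (partial_y j) S3 = (\<lambda>q. chernov.s1 j (vel q))" for j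
    by (simp add: fun_eq_iff S3_eq act_vel[OF chernov.GDERIV_cub] partial_y_def inner_axis')
  then show ?thesis
    by (simp add: hessian_S3_def act_vel[OF chernov.GDERIV_s1] partial_y_def inner_axis'
        chernov.s2_commute)
qed

lemma chernov_domain_iff:
  "p \<in> chernov_domain U \<longleftrightarrow> fst (snd p) \<in> U \<and> chernov.regular (vel p)"
  by (cases p) (simp add: chernov_domain_def chernov.regular_def hessian_S3_eq S3_eq)

lemma open_vel:
  assumes "open S"
  shows "open {q::jet. vel q \<in> S}"
proof -
  have "continuous_on UNIV (\<lambda>q::jet. vel q)"
    by (intro continuous_intros)
  from open_vimage[OF assms this] show ?thesis
    by (simp add: vimage_def)
qed

lemma open_cub_nonzero: "open {q::jet. chernov.cub (vel q) \<noteq> 0}"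
proof -
  have "open {y. chernov.cub y \<noteq> 0}"
    using chernov.continuous_cub by (intro open_Collect_neq continuous_on_const)
  from open_vel[OF this] show ?thesis
    by simp
qed

lemma g3_eq:
  assumes "temporal_metric h" "chernov.cub (vel p) \<noteq> 0"
  shows "g3 h i j p = chernov.energy2 i j (vel p)"
proof -
  have h: "h t > 0" for t
    using assms(1) by (simp add: temporal_metric_def)
  have inv: "DERIV (\<lambda>t. 1 / h t) t :> - deriv h t / (h t)\<^sup>2" for t
    using h[of t] temporal_metric_DERIV[OF assms(1), of t]
    by (auto intro!: derivative_eq_intros simp: power2_eq_square)
  \<comment> \<open>Positivity of \<open>h\<close> removes the square root, so the metric separates
    into a time factor and a velocity factor.\<close>
  have F: "(\<lambda>q. (F3 h q)\<^sup>2) = (\<lambda>q. 1 / h (time q) * (chernov.croot (vel q))\<^sup>2)"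
    using h by (simp add: F3_def S3_eq chernov.croot_def power_mult_distrib power_divide fun_eq_iff less_imp_le)
  have "act (partial_y j) (\<lambda>q. (F3 h q)\<^sup>2) q
      = 2 / h (time q) * (chernov.s1 j (vel q) / (3 * chernov.croot (vel q)))"
    if "chernov.cub (vel q) \<noteq> 0" for q
    unfolding F act_time_mult_vel[OF inv chernov.GDERIV_energy[OF that]]
    by (simp add: partial_y_def inner_axis')
  then have "act (partial_y i) (act (partial_y j) (\<lambda>q. (F3 h q)\<^sup>2)) p
      = act (partial_y i) (\<lambda>q. 2 / h (time q) * (chernov.s1 j (vel q) / (3 * chernov.croot (vel q)))) p"
    by (intro act_cong_open[OF open_cub_nonzero]) (use assms in simp_all)
  also have "(\<lambda>q::jet. 2 / h (time q) * (chernov.s1 j (vel q) / (3 * chernov.croot (vel q))))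
      = (\<lambda>q. (2 * (1 / h (time q))) * (chernov.s1 j (vel q) / (3 * chernov.croot (vel q))))"
    by simp
  also have "act (partial_y i) \<dots> p = 2 / h (time p) * chernov.energy2 j i (vel p)"
    unfolding act_time_mult_vel[OF DERIV_cmult[OF inv] chernov.GDERIV_energy_gradient[OF assms(2)]]
    by (simp add: partial_y_def inner_axis')
  finally show ?thesis
    using h[of "time p"] by (simp add: g3_def chernov.energy2_commute[of i])
qed

lemma open_regular_jet: "open {q::jet. chernov.regular (vel q)}"
  using open_vel[OF chernov.open_regular] by simp

lemma act_g3:
  assumes "temporal_metric h" "chernov.cub (vel p) \<noteq> 0"
  shows "act X (g3 h i j) p = (\<Sum>k\<in>UNIV. vel (X p) $ k * chernov.energy3 i j k (vel p))"
proof -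
  have "act X (g3 h i j) p = act X (\<lambda>q. chernov.energy2 i j (vel q)) p"
    by (rule act_cong_open[OF open_cub_nonzero]) (simp_all add: assms g3_eq)
  then show ?thesis
    by (simp add: act_vel[OF chernov.GDERIV_energy2[OF assms(2)]] inner_vec_def)
qed

text \<open>On functions of the velocity alone, \<open>delta_x h k\<close> acts as
  \<open>kappa / 2\<close> times \<open>partial_y k\<close>, and \<open>delta_t h\<close> acts as
  \<open>kappa\<close> times the Euler field.\<close>

lemma
  assumes "temporal_metric h" "chernov.regular (vel p)"
  shows cartan_C_eq: "cartan_C h i j k p = chernov.christoffel i j k (vel p)"
    and cartan_L_eq: "cartan_L h i j k p = kappa h (time p) / 2 * chernov.christoffel i j k (vel p)"
    and cartan_G_eq: "cartan_G h i j p = 0"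
proof -
  have cub: "chernov.cub (vel p) \<noteq> 0"
    using assms(2) by (simp add: chernov.regular_def)
  have inv: "g3_inv h i m p = matrix_inv (\<chi> a b. chernov.energy2 a b (vel p)) $ i $ m" for m
    by (simp add: g3_inv_def g3_eq[OF assms(1) cub])
  have energy3: "chernov.energy3 j m k (vel p) + chernov.energy3 k m j (vel p) - chernov.energy3 j k m (vel p) = chernov.energy3 j k m (vel p)" for m
    using chernov.energy3_swap12 chernov.energy3_swap23
    by (smt (verit))
  have y: "act (partial_y k) (g3 h i j) p = chernov.energy3 i j k (vel p)" for i j k
    by (simp add: act_g3[OF assms(1) cub] partial_y_def sum_axis_mult mult.assoc flip: sum_distrib_left sum_divide_distrib)
  show "cartan_C h i j k p = chernov.christoffel i j k (vel p)"
    by (simp add: cartan_C_def chernov.christoffel_def inv y energy3)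
  have x: "act (delta_x h k) (g3 h i j) p = kappa h (time p) / 2 * chernov.energy3 i j k (vel p)" for i j k
    by (simp add: act_g3[OF assms(1) cub] delta_x_eq sum_axis_mult mult.assoc flip: sum_distrib_left sum_divide_distrib)
  have "cartan_L h i j k p = (\<Sum>m\<in>UNIV. g3_inv h i m p / 2 * (kappa h (time p) / 2 *
     (chernov.energy3 j m k (vel p) + chernov.energy3 k m j (vel p) - chernov.energy3 j k m (vel p))))"
    by (simp only: cartan_L_def x ring_distribs)
  also have "\<dots> = kappa h (time p) / 2 * chernov.christoffel i j k (vel p)"
    by (simp add: energy3 inv chernov.christoffel_def sum_distrib_left mult_ac)
  finally show "cartan_L h i j k p = kappa h (time p) / 2 * chernov.christoffel i j k (vel p)" .
  have "act (delta_t h) (g3 h i j) p = 0" for i j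
    using chernov.euler_energy3[OF cub, of i j]
    by (simp add: act_g3[OF assms(1) cub] delta_t_eq mult_ac flip: sum_distrib_left)
  then show "cartan_G h i j p = 0"
    by (simp add: cartan_G_def)
qed

section \<open>Derivatives of the connection coefficients and the five d-tensors\<close>

context
  fixes h :: "real \<Rightarrow> real" and p :: jet
  assumes h: "temporal_metric h" and p: "chernov.regular (vel p)"
begin

lemma act_cartan_C:
  "act X (cartan_C h i j k) p = (\<Sum>l\<in>UNIV. vel (X p) $ l * chernov.dchristoffel i j k l (vel p))"
proof -
  have "act X (cartan_C h i j k) p = act X (\<lambda>q. chernov.christoffel i j k (vel q)) p"
    by (rule act_cong_open[OF open_regular_jet]) (simp_all add: h p cartan_C_eq)
  then show ?thesis
    by (simp add: act_vel[OF chernov.GDERIV_christoffel[OF p]] inner_vec_def)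
qed

lemma act_cartan_L:
  "act X (cartan_L h i j k) p = deriv (kappa h) (time p) / 2 * time (X p) * chernov.christoffel i j k (vel p)
    + kappa h (time p) / 2 * act X (cartan_C h i j k) p"
proof -
  have "act X (cartan_L h i j k) p = act X (\<lambda>q. kappa h (time q) / 2 * chernov.christoffel i j k (vel q)) p"
    by (rule act_cong_open[OF open_regular_jet]) (simp_all add: h p cartan_L_eq)
  then show ?thesis
    by (simp only: act_time_mult_vel[OF DERIV_cdivide[OF temporal_metric_DERIV_kappa[OF h]]
        chernov.GDERIV_christoffel[OF p]] act_cartan_C inner_vec_def) simp
qed

lemma act_cartan_G: "act X (cartan_G h i j) p = 0"
proof -
  have "act X (cartan_G h i j) p = act X (\<lambda>q. 0) p"
    by (rule act_cong_open[OF open_regular_jet]) (simp_all add: h p cartan_G_eq)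
  then show ?thesis
    by (simp add: act_const)
qed

lemma act_partial_y_cartan_C: "act (partial_y l) (cartan_C h i j k) p = chernov.dchristoffel i j k l (vel p)"
  by (simp add: act_cartan_C partial_y_def sum_axis_mult mult.assoc flip: sum_distrib_left sum_divide_distrib)

lemma act_delta_x_cartan_C:
  "act (delta_x h l) (cartan_C h i j k) p = kappa h (time p) / 2 * chernov.dchristoffel i j k l (vel p)"
  by (simp add: act_cartan_C delta_x_eq sum_axis_mult mult.assoc flip: sum_distrib_left sum_divide_distrib)

lemma act_delta_t_cartan_C:
  "act (delta_t h) (cartan_C h i j k) p = - kappa h (time p) * chernov.christoffel i j k (vel p)"
  using chernov.euler_christoffel[OF p, of i j k]
  by (simp add: act_cartan_C delta_t_eq mult_ac flip: sum_distrib_left)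

lemma S_vv_eq_curv: "S_vv h l i j k p = chernov.curv l i j k (vel p)"
  by (simp add: S_vv_eq act_partial_y_cartan_C chernov.curv_def cartan_C_eq[OF h p])

text \<open>Each derivative term and each quadratic term picks up \<open>kappa / 2\<close> twice.
  The derivative of \<open>kappa\<close> is absent since \<open>delta_x\<close> has no time
  component.\<close>

lemma R_hh_eq: "R_hh h l i j k p = 1/4 * kappa h (time p) * kappa h (time p) * S_vv h l i j k p"
  using coframe_curvature_frame_commuting[of h "Horizontal k" "Horizontal j" p l i,
      unfolded frame.simps, OF lie_bracket_delta_x_delta_x[OF h]]
  by (simp add: R_hh_def S_vv_eq_curv act_cartan_L
      act_delta_x_cartan_C chernov.curv_def cartan_L_eq[OF h p] delta_x_eq[of h _ p]
      sum_distrib_left algebra_simps del: coframe.simps)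

text \<open>Only one of the two directions is horizontal, so every term picks up a single
  \<open>kappa / 2\<close>.\<close>

lemma P_hv_eq: "P_hv h l i j k p = 1/2 * kappa h (time p) * S_vv h l i j k p"
  using coframe_curvature_frame_commuting[of h "Vertical k" "Horizontal j" p l i,
      unfolded frame.simps, OF lie_bracket_partial_y_delta_x[OF h]]
  by (simp add: P_hv_def S_vv_eq_curv act_cartan_L
      act_delta_x_cartan_C act_partial_y_cartan_C chernov.curv_def cartan_L_eq[OF h p]
      cartan_C_eq[OF h p] partial_y_def[of _ p] sum_distrib_left algebra_simps del: coframe.simps)

text \<open>\<open>delta_t h\<close> maps \<open>cartan_L\<close> to
  \<open>(deriv kappa - kappa^2) / 2\<close> times \<open>cartan_C\<close>; entering with a minus
  sign, this cancels the bracket term.\<close>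

lemma R_th_eq_0: "R_th h l i k p = 0"
  using coframe_curvature_frame_vertical_bracket[of h "Horizontal k" Temporal p _ k l i,
      unfolded frame.simps, OF lie_bracket_delta_x_delta_t[OF h]]
  by (simp add: R_th_def act_cartan_G act_cartan_L act_delta_t_cartan_C cartan_G_eq[OF h p]
      cartan_C_eq[OF h p] delta_t_eq[of h p] power2_eq_square field_simps del: coframe.simps)

lemma P_tv_eq_0: "P_tv h l i k p = 0"
  using coframe_curvature_frame_vertical_bracket[of h "Vertical k" Temporal p _ k l i,
      unfolded frame.simps, OF lie_bracket_partial_y_delta_t[OF h]]
  by (simp add: P_tv_def act_cartan_G act_delta_t_cartan_C cartan_G_eq[OF h p]
      cartan_C_eq[OF h p] del: coframe.simps)

end

text \<open>
  At \<open>(1, 1, 1, 1)\<close> all tensors are rational up to powers of the cube root: the vector \<open>(1, 1, 1, 1)\<close>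
  annihilates \<open>energy3\<close>, and \<open>energy2\<close> is a multiple of the identity up to the all-ones matrix.
\<close>

lemma
  shows regular_ones: "chernov.regular (\<chi> i. 1)"
    and curv_ones_nonzero: "\<exists>l. chernov.curv l 1 1 2 (\<chi> i. 1) \<noteq> 0"
proof -
  let ?y = "\<chi> i. 1 :: real^4"
  have s2: "chernov.s2 i j ?y = (if i = j then 0 else 2)" for i j
  proof -
    have "\<forall>i j. chernov.s2 i j ?y = (if i = j then 0 else 2)"
      by (simp add: forall_4 chernov.s2_def sum_4 chernov_coeff_def)
    then show ?thesis by blast
  qed
  have s1: "chernov.s1 i ?y = 3" for i
  proof -
    have "\<forall>i. chernov.s1 i ?y = 3"
      by (simp add: forall_4 chernov.s1_def s2 sum_4)
    then show ?thesis by blast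
  qed
  have cub: "chernov.cub ?y = 4"
    by (simp add: chernov.cub_def s1 sum_4)
  \<comment> \<open>With \<open>J\<close> the all-ones matrix, \<open>s2\<close> is
    \<open>2 (J - I)\<close>; since \<open>J J = 4 J\<close>, its inverse is
    \<open>J / 6 - I / 2\<close>.\<close>
  have "(\<chi> i j. chernov.s2 i j ?y) ** (\<chi> i j. if i = j then - 1 / 3 else 1 / 6) = mat 1"
    by (simp add: s2 vec_eq_iff forall_4 matrix_matrix_mult_def sum_4 mat_def)
  then show reg: "chernov.regular ?y"
    unfolding chernov.regular_def using cub invertible_right_inverse by (metis zero_neq_numeral)
  define r where "r = chernov.croot ?y"
  have r3: "r * (r * r) = 4"
    using chernov.croot_pow3[of ?y] by (simp add: r_def cub power3_eq_cube)
  then have "r \<noteq> 0" by auto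
  have r4: "r ^ 4 = 4 * r" and r7: "r ^ 7 = 16 * r"
    using r3 by (simp_all add: eval_nat_numeral)
  \<comment> \<open>Integer rescaling of \<open>energy3\<close> by \<open>12 * r\<close>.\<close>
  define \<tau> where "\<tau> i j k = 4 * chernov_coeff i j k
    - (chernov.s2 i j ?y + chernov.s2 i k ?y + chernov.s2 j k ?y) + 3" for i j k
  have energy3: "chernov.energy3 i j k ?y = \<tau> i j k / (12 * r)" for i j k
    using \<open>r \<noteq> 0\<close> by (simp add: chernov.energy3_def s1 r4 r7 \<tau>_def flip: r_def) (simp add: field_simps)
  have energy2: "chernov.energy2 i j ?y = (if i = j then - 3 else 5) / (12 * r)" for i j
    using \<open>r \<noteq> 0\<close> by (simp add: chernov.energy2_def s1 s2 r4 field_simps flip: r_def)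
  \<comment> \<open>The metric is \<open>(5 J - 8 I) / (12 r)\<close> and \<open>J\<close>
    annihilates \<tau>, so the metric acts on \<tau> as the scalar \<open>- 8 / (12 r)\<close>;
    \<open>energy2_injective\<close> then identifies the symbols.\<close>
  have christoffel: "chernov.christoffel m j k ?y = - \<tau> j k m / 16" for m j k
  proof -
    have "\<forall>j k i. (\<Sum>m\<in>UNIV. (if i = m then - 3 else 5) * \<tau> j k m) = - 8 * \<tau> j k i"
      by (simp add: forall_4 sum_4 \<tau>_def s2 chernov_coeff_def)
    then have \<tau>: "(\<Sum>m\<in>UNIV. (if i = m then - 3 else 5) * \<tau> j k m) = - 8 * \<tau> j k i" for i j k
      by blast
    have "(\<Sum>m\<in>UNIV. chernov.energy2 i m ?y * (\<tau> j k m / 16)) = - \<tau> j k i / (24 * r)" for i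
    proof -
      have "(\<Sum>m\<in>UNIV. chernov.energy2 i m ?y * (\<tau> j k m / 16))
          = (\<Sum>m\<in>UNIV. (if i = m then - 3 else 5) * \<tau> j k m) / (192 * r)"
        unfolding sum_divide_distrib by (intro sum.cong) (simp_all add: energy2)
      then show ?thesis
        by (simp add: \<tau>)
    qed
    then have "(\<Sum>m\<in>UNIV. chernov.energy2 i m ?y * (chernov.christoffel m j k ?y + \<tau> j k m / 16)) = 0" for i
      by (simp add: distrib_left sum.distrib chernov.energy2_christoffel[OF reg] energy3)
    from chernov.energy2_injective[OF reg this, of m] show ?thesis
      by simp
  qed
  show "\<exists>l. chernov.curv l 1 1 2 ?y \<noteq> 0"
  proof (rule ccontr)
    assume "\<not> ?thesis"
    \<comment> \<open>If all components over \<open>l\<close> vanished, so would the lowered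
      component with first index 2, which is computable from \<tau>.\<close>
    then have "0 = (\<Sum>l\<in>UNIV. chernov.energy2 2 l ?y * chernov.curv l 1 1 2 ?y)"
      by simp
    also have "\<dots> = - 1 / (48 * r)"
      unfolding chernov.energy2_curv[OF reg]
      using \<open>r \<noteq> 0\<close> by (simp add: energy3 christoffel sum_4 \<tau>_def s2 chernov_coeff_def field_simps)
    finally show False
      using \<open>r \<noteq> 0\<close> by simp
  qed
qed

theorem theorem4p4:
  fixes h :: "real \<Rightarrow> real" and U :: "(real^4) set"
  assumes "temporal_metric h" and "open U" and "U \<noteq> {}"
  shows "(\<forall>p\<in>chernov_domain U. \<forall>l i j k.
            R_hh h l i j k p = 1/4 * kappa h (time p) * kappa h (time p) * S_vv h l i j k p
          \<and> P_hv h l i j k p = 1/2 * kappa h (time p) * S_vv h l i j k p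
          \<and> S_vv h l i j k p =
              act (partial_y k) (cartan_C h l i j) p - act (partial_y j) (cartan_C h l i k) p
              + (\<Sum>m\<in>UNIV. cartan_C h m i j p * cartan_C h l m k p)
              - (\<Sum>m\<in>UNIV. cartan_C h m i k p * cartan_C h l m j p)
          \<and> R_th h l i k p = 0
          \<and> P_tv h l i k p = 0)
       \<and> not_identically_zero (chernov_domain U) (S_vv h)
       \<and> ((\<exists>t. kappa h t \<noteq> 0) \<longrightarrow>
            not_identically_zero (chernov_domain U) (R_hh h)
          \<and> not_identically_zero (chernov_domain U) (P_hv h))"
proof (intro conjI impI)
  show "\<forall>p\<in>chernov_domain U. \<forall>l i j k.
            R_hh h l i j k p = 1/4 * kappa h (time p) * kappa h (time p) * S_vv h l i j k p
          \<and> P_hv h l i j k p = 1/2 * kappa h (time p) * S_vv h l i j k p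
          \<and> S_vv h l i j k p =
              act (partial_y k) (cartan_C h l i j) p - act (partial_y j) (cartan_C h l i k) p
              + (\<Sum>m\<in>UNIV. cartan_C h m i j p * cartan_C h l m k p)
              - (\<Sum>m\<in>UNIV. cartan_C h m i k p * cartan_C h l m j p)
          \<and> R_th h l i k p = 0
          \<and> P_tv h l i k p = 0"
    by (intro ballI allI conjI)
       (rule R_hh_eq P_hv_eq S_vv_eq R_th_eq_0 P_tv_eq_0; simp add: assms(1) chernov_domain_iff)+
  obtain x where "x \<in> U"
    using assms(3) by blast
  then have dom: "(t, x, \<chi> i. 1) \<in> chernov_domain U" for t
    by (simp add: chernov_domain_iff regular_ones)
  \<comment> \<open>One \<open>l\<close> serves all times, as \<open>curv\<close> depends on the
    velocity only.\<close>
  obtain l where l: "S_vv h l 1 1 2 (t, x, \<chi> i. 1) \<noteq> 0" for t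
    using curv_ones_nonzero S_vv_eq_curv[OF assms(1), of "(_, x, \<chi> i. 1)"] regular_ones
    by auto
  then show "not_identically_zero (chernov_domain U) (S_vv h)"
    unfolding not_identically_zero_def using dom by blast
  assume "\<exists>t. kappa h t \<noteq> 0"
  then obtain t where t: "kappa h t \<noteq> 0"
    by blast
  let ?p = "(t, x, \<chi> i. 1) :: jet"
  have "R_hh h l 1 1 2 ?p \<noteq> 0" "P_hv h l 1 1 2 ?p \<noteq> 0"
    using t l[of t] R_hh_eq[OF assms(1), of ?p l 1 1 2] P_hv_eq[OF assms(1), of ?p l 1 1 2] regular_ones
    by auto
  then show "not_identically_zero (chernov_domain U) (R_hh h)"
    and "not_identically_zero (chernov_domain U) (P_hv h)"
    unfolding not_identically_zero_def using dom by blast+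
qed

end
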